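(* Let $0<\rho\le 1$, let $0<\alpha<1$ and let $0<D_1\le D_2$ be constants. For each $n$ let $\tau=\tau(n)$ be an integer with $1\le \tau\le n-1$ and $\tau\ge \rho n$, let $\{w(i,j)\}_{1\le i<j\le n}$ be independent random variables with $w(i,j)\le 1$, and suppose that their cumulative distribution functions $F_{i,j}$ satisfy $$D_1x^{1/\alpha}\le F_{i,j}(x)\le D_2x^{1/\alpha}\qquad\text{for all } 0\le x\le 1 \text{ and all } 1\le i<j\le n.$$ Let $M_n=M_n(\tau)$ be the minimum weight of a tree in $K_n$ having at least $\tau$ edges. Then there are positive constants $C_1,C_2,C_3$, not depending on $n$, such that for all such $n$ $$\mathbb{P}\left(C_1n^{1-\alpha}\le M_n\le C_2n^{1-\alpha}\right)\ge 1-e^{-C_3n^{1-\alpha}}$$ and $$C_1n^{1-\alpha}\le \mathbb{E}M_n\le C_2n^{1-\alpha}.$$ Moreover, $\mathrm{var}(M_n)\le 2n$.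
   Context: $K_n$ is the complete graph on the vertex set $\{1,2,\ldots,n\}$. For $1\le j<i\le n$ set $w(i,j):=w(j,i)$; the weight of the edge $e=(i,j)$ of $K_n$ is $w(e):=w(i,j)$. A tree in $K_n$ is a connected acyclic subgraph (not necessarily spanning). The weight of a tree $\mathcal{T}$ is $W(\mathcal{T}):=\sum_{e\in\mathcal{T}}w(e)$, the sum over the edges of $\mathcal{T}$. For $1\le\tau\le n-1$, $M_n=M_n(\tau):=\min_{\mathcal{T}}W(\mathcal{T})$, where the minimum is over all trees $\mathcal{T}\subset K_n$ having at least $\tau$ edges. $\mathrm{var}$ denotes variance. *)

theory Defs
  imports "HOL-Probability.Probability"
begin

text \<open>
  A graph is a pair of a vertex set and a set of edges, each edge being a two-element set of vertices.
\<close>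

definition complete_edges :: "nat set \<Rightarrow> nat set set" where
  "complete_edges V = {{u, v} | u v. u \<in> V \<and> v \<in> V \<and> u \<noteq> v}"

definition is_walk :: "nat set set \<Rightarrow> nat list \<Rightarrow> bool" where
  "is_walk E xs \<longleftrightarrow> xs \<noteq> [] \<and> successively (\<lambda>u v. {u, v} \<in> E) xs"

definition connected_graph :: "nat set \<Rightarrow> nat set set \<Rightarrow> bool" where
  "connected_graph V E \<longleftrightarrow>
     V \<noteq> {} \<and> (\<forall>u\<in>V. \<forall>v\<in>V. \<exists>xs. is_walk E xs \<and> hd xs = u \<and> last xs = v)"

definition is_cycle :: "nat set set \<Rightarrow> nat list \<Rightarrow> bool" where
  "is_cycle E xs \<longleftrightarrow> is_walk E xs \<and> distinct xs \<and> 3 \<le> length xs \<and> {last xs, hd xs} \<in> E"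

definition acyclic_graph :: "nat set set \<Rightarrow> bool" where
  "acyclic_graph E \<longleftrightarrow> (\<nexists>xs. is_cycle E xs)"

text \<open>Trees in the complete graph on the vertices $1, \ldots, n$; they need not be spanning.\<close>

definition trees :: "nat \<Rightarrow> (nat set \<times> nat set set) set" where
  "trees n = {(V, E). V \<subseteq> {1..n} \<and> E \<subseteq> complete_edges V \<and> connected_graph V E \<and> acyclic_graph E}"

text \<open>
  Only the values \<open>w i j\<close> with \<open>i < j\<close> are weights; the convention $w(i,j) = w(j,i)$ amounts to
  reading off the weight of an edge with its smaller endpoint first.
\<close>

definition edge_weight :: "(nat \<Rightarrow> nat \<Rightarrow> real) \<Rightarrow> nat set \<Rightarrow> real" where
  "edge_weight w e = w (Min e) (Max e)"

definition tree_weight :: "(nat \<Rightarrow> nat \<Rightarrow> real) \<Rightarrow> nat set \<times> nat set set \<Rightarrow> real" where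
  "tree_weight w T = (\<Sum>e\<in>snd T. edge_weight w e)"

text \<open>
  The set below is finite, and it is nonempty for $t \le n - 1$ and $n \ge 1$.
\<close>

definition min_tree_weight :: "nat \<Rightarrow> nat \<Rightarrow> (nat \<Rightarrow> nat \<Rightarrow> real) \<Rightarrow> real" where
  "min_tree_weight n t w = Min (tree_weight w ` {T \<in> trees n. t \<le> card (snd T)})"

end

theory Submission imports Defs begin

text \<open>
  Call an edge light if its weight is at most $c\, n^{-\alpha}$. The number of light edges of $K_n$ is a
  sum of independent indicators with mean at most $\delta n$, where $\delta$ is small with $c$; off an
  event of exponentially small probability it is below $\rho n / 2$, so a tree with at least $\rho n$
  edges has at least $\rho n / 2$ edges that are not light. This gives the lower bounds without any
  counting of trees.

  For the upper bounds, join each vertex $i \ge 2$ to the vertex $j < i$ with $w(i,j)$ minimal. This is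
  a spanning tree, its edge weights are independent because they involve disjoint sets of weights, and
  the $i$-th one has mean of order $(i-1)^{-\alpha}$, so a Chernoff bound applies to the sum.

  The variance bound is the Efron--Stein inequality: raising one weight to its maximal value 1 increases
  $M_n$ by at most 1, and not at all if the edge lies outside a fixed minimal tree, which has at most
  $n$ edges.
\<close>

section \<open>Trees in the complete graph\<close>

text \<open>The threshold is dictated by the hypothesis on the distribution functions: the power
  \<open>1 / \<alpha>\<close> of \<open>n powr (- \<alpha>)\<close> is \<open>1 / n\<close>, so with
  at most \<open>n^2\<close> pairs the mean number of light ones is at most linear in
  \<open>n\<close>, with a factor that tends to 0 with \<open>c\<close>. The two failure events
  differ in size. Too many light edges is exponentially unlikely in \<open>n\<close>; the weight of
  the recursive tree has mean at most of order \<open>n powr (1 - \<alpha>)\<close>, and its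
  Chernoff bound decays only at that scale, which explains the exponent in the probability. Weights
  lie in the unit interval only almost surely, and the distribution functions are controlled only
  there. The probabilistic lemmas therefore use weights clamped to \<open>[0, 1]\<close>. For the
  variance, a weight is raised to 1 instead of resampled: a resampled weight may drop and make an
  edge outside the minimal tree attractive, while a raised one cannot, so the influential edges can
  be counted for each fixed choice of weights.\<close>

lemma is_walk_simps:
  "is_walk E [u]"
  "is_walk E (u # v # xs) \<longleftrightarrow> {u, v} \<in> E \<and> is_walk E (v # xs)"
  by (auto simp: is_walk_def)

lemma is_walk_append:
  assumes "is_walk E xs" "is_walk E ys" "{last xs, hd ys} \<in> E"
  shows "is_walk E (xs @ ys)"
  using assms by (auto simp: is_walk_def successively_append_iff)

lemma is_walk_join:
  assumes "is_walk E xs" "is_walk E ys" "last xs = hd ys"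
  shows "is_walk E (xs @ tl ys) \<and> hd (xs @ tl ys) = hd xs \<and> last (xs @ tl ys) = last ys"
proof (cases ys)
  case Nil
  with assms show ?thesis by (simp add: is_walk_def)
next
  case (Cons y zs)
  with assms show ?thesis
    by (cases zs) (auto simp: is_walk_def successively_append_iff)
qed

lemma is_walk_rev: "is_walk E (rev xs) \<longleftrightarrow> is_walk E xs"
  by (simp add: is_walk_def insert_commute)

lemma acyclic_graph_mono: "acyclic_graph E \<Longrightarrow> E' \<subseteq> E \<Longrightarrow> acyclic_graph E'"
  unfolding acyclic_graph_def is_cycle_def is_walk_def
  by (blast intro: successively_mono)

lemma finite_complete_edges: "finite V \<Longrightarrow> finite (complete_edges V)"
  by (rule finite_subset[of _ "Pow V"]) (auto simp: complete_edges_def)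

lemma finite_trees: "finite (trees n)"
proof (rule finite_subset)
  show "trees n \<subseteq> Pow {1..n} \<times> Pow (Pow {1..n})"
    by (auto simp: trees_def complete_edges_def)
qed auto

section \<open>Edge count of acyclic graphs\<close>

lemma card_incident_eq_degree:
  assumes "v \<in> V" "E \<subseteq> complete_edges V"
  shows "card {e \<in> E. v \<in> e} = card {u. {u, v} \<in> E}"
proof -
  have "e \<in> (\<lambda>u. {u, v}) ` {u. {u, v} \<in> E}" if "e \<in> E" "v \<in> e" for e
  proof -
    obtain a b where "e = {a, b}" using assms \<open>e \<in> E\<close> unfolding complete_edges_def by blast
    with that have "e = {a, v} \<or> e = {b, v}" by auto
    with that show ?thesis by auto
  qed
  then have "{e \<in> E. v \<in> e} = (\<lambda>u. {u, v}) ` {u. {u, v} \<in> E}"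
    by auto
  moreover have "inj_on (\<lambda>u. {u, v}) {u. {u, v} \<in> E}"
    by (auto simp: inj_on_def doubleton_eq_iff)
  ultimately show ?thesis
    by (simp add: card_image)
qed

text \<open>Take a longest path. All neighbours of its first vertex lie on it, since otherwise it
  could be extended at the front. A neighbour other than the second vertex closes an initial segment
  of the path to a cycle.\<close>

lemma cycle_exists:
  assumes "finite V" "V \<noteq> {}" "E \<subseteq> complete_edges V"
    and deg: "\<And>v. v \<in> V \<Longrightarrow> 2 \<le> card {u. {u, v} \<in> E}"
  shows "\<not> acyclic_graph E"
proof -
  have inV: "u \<in> V \<and> v \<in> V \<and> u \<noteq> v" if "{u, v} \<in> E" for u v
    using that assms(3) by (auto simp: complete_edges_def doubleton_eq_iff)
  define Q where "Q xs \<longleftrightarrow> is_walk E xs \<and> distinct xs \<and> set xs \<subseteq> V" for xs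
  obtain v0 where "v0 \<in> V" using assms(2) by auto
  then have "Q [v0]" by (simp add: Q_def is_walk_simps)
  moreover have "length xs \<le> card V" if "Q xs" for xs
    using that assms(1) by (metis Q_def card_mono distinct_card)
  ultimately obtain xs where xs: "Q xs" and longest: "\<And>ys. Q ys \<Longrightarrow> length ys \<le> length xs"
    using ex_has_greatest_nat[of Q "[v0]" length "Suc (card V)"] by (auto simp: less_Suc_eq_le)
  then obtain v vs where v: "xs = v # vs"
    by (cases xs) (auto simp: Q_def is_walk_def)
  then have "v \<in> V" using xs by (auto simp: Q_def)
  have nbr: "u \<in> set vs" if "{u, v} \<in> E" for u
  proof (rule ccontr)
    assume "u \<notin> set vs"
    then have "Q (u # xs)"
      using that xs inV[OF that] by (auto simp: Q_def v is_walk_simps)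
    then show False using longest by fastforce
  qed
  \<comment> \<open>If \<open>vs\<close> is empty its head is an unspecified vertex; this is
    harmless, because two neighbours fit into no singleton.\<close>
  have "\<not> {u. {u, v} \<in> E} \<subseteq> {hd vs}"
    using deg[OF \<open>v \<in> V\<close>] card_mono[of "{hd vs}" "{u. {u, v} \<in> E}"] by auto
  then obtain u where u: "{u, v} \<in> E" "u \<noteq> hd vs" by auto
  obtain as bs where vs: "vs = as @ u # bs"
    using nbr[OF u(1)] by (meson split_list)
  with u(2) have "as \<noteq> []" by auto
  have "successively (\<lambda>x y. {x, y} \<in> E) ((v # as) @ u # bs)"
    using xs by (simp add: Q_def is_walk_def v vs)
  then have "is_walk E ((v # as) @ [u])"
    unfolding is_walk_def successively_append_iff by auto
  then have "is_cycle E ((v # as) @ [u])"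
    using xs u(1) \<open>as \<noteq> []\<close> by (cases as) (auto simp: is_cycle_def Q_def v vs)
  then show ?thesis by (auto simp: acyclic_graph_def)
qed

text \<open>By \<open>cycle_exists\<close> some vertex has degree at most 1, and deleting it removes
  at most one edge. The bound is one above the sharp value for nonempty \<open>V\<close>, which
  allows the induction to start from the empty set.\<close>

lemma acyclic_card_edges_le:
  assumes "finite V" "E \<subseteq> complete_edges V" "acyclic_graph E"
  shows "card E \<le> card V"
  using assms
proof (induction V arbitrary: E rule: finite_psubset_induct)
  case (psubset V)
  show ?case
  proof (cases "V = {}")
    case True
    with psubset.prems show ?thesis by (auto simp: complete_edges_def)
  next
    case False
    with psubset obtain v where v: "v \<in> V" "card {u. {u, v} \<in> E} < 2"
      using cycle_exists[of V E] by (meson not_le)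
    let ?E = "{e \<in> E. v \<notin> e}"
    have "finite E"
      using psubset finite_complete_edges finite_subset by blast
    have "card ?E \<le> card (V - {v})"
    proof (rule psubset.IH)
      show "?E \<subseteq> complete_edges (V - {v})"
      proof
        fix e assume e: "e \<in> ?E"
        then obtain a b where "e = {a, b}" "a \<in> V" "b \<in> V" "a \<noteq> b"
          using psubset.prems(1) unfolding complete_edges_def by blast
        with e show "e \<in> complete_edges (V - {v})" by (auto simp: complete_edges_def)
      qed
      show "acyclic_graph ?E"
        using psubset.prems(2) by (rule acyclic_graph_mono) auto
    qed (use v in auto)
    moreover have "card E = card ?E + card {e \<in> E. v \<in> e}"
    proof -
      have "card (?E \<union> {e \<in> E. v \<in> e}) = card ?E + card {e \<in> E. v \<in> e}"
        using \<open>finite E\<close> by (intro card_Un_disjoint) auto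
      moreover have "?E \<union> {e \<in> E. v \<in> e} = E" by blast
      ultimately show ?thesis by simp
    qed
    moreover have "card {e \<in> E. v \<in> e} \<le> 1"
      using card_incident_eq_degree[OF v(1) psubset.prems(1)] v(2) by linarith
    moreover have "card V = Suc (card (V - {v}))"
      using card.remove[OF psubset.hyps(1) v(1)] .
    ultimately show ?thesis by linarith
  qed
qed

section \<open>Trees given by a parent function\<close>

text \<open>Following parents decreases the label until vertex 1 is reached, whence connectedness.
  On a cycle, the vertex with the largest label would have two different neighbours of smaller
  label, but only its parent qualifies.\<close>

lemma recursive_tree:
  assumes "1 \<le> n" and p: "\<And>i. i \<in> {2..n} \<Longrightarrow> p i \<in> {1..<i}"
  shows "({1..n}, (\<lambda>i. {p i, i}) ` {2..n}) \<in> trees n"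
proof -
  let ?E = "(\<lambda>i. {p i, i}) ` {2..n}"
  have edge: "u = p v" if "{u, v} \<in> ?E" "u \<le> v" for u v
    using that p by (force simp: doubleton_eq_iff)
  have to_root: "\<exists>xs. is_walk ?E xs \<and> hd xs = u \<and> last xs = 1" if "1 \<le> u" "u \<le> n" for u
    using that
  proof (induction u rule: less_induct)
    case (less u)
    show ?case
    proof (cases "u = 1")
      case True
      then show ?thesis by (intro exI[of _ "[1]"]) (simp add: is_walk_simps)
    next
      case False
      with less have u: "u \<in> {2..n}" by auto
      with p[OF this] less obtain xs where xs: "is_walk ?E xs" "hd xs = p u" "last xs = 1"
        by fastforce
      then have "is_walk ?E ([u] @ xs)"
        using u by (intro is_walk_append) (auto simp: is_walk_simps insert_commute)
      then show ?thesis using xs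
        by (intro exI[of _ "u # xs"]) (auto simp: is_walk_def)
    qed
  qed
  have "connected_graph {1..n} ?E"
    unfolding connected_graph_def
  proof (intro conjI ballI)
    show "{1..n} \<noteq> {}" using assms by auto
    fix u v assume "u \<in> {1..n}" "v \<in> {1..n}"
    then obtain xs ys where xs: "is_walk ?E xs" "hd xs = u" "last xs = 1"
      and ys: "is_walk ?E ys" "hd ys = v" "last ys = 1"
      using to_root[of u] to_root[of v] by auto
    have "is_walk ?E (rev ys)" "last xs = hd (rev ys)" "last (rev ys) = v"
      using xs ys by (simp_all add: is_walk_rev hd_rev last_rev)
    with xs show "\<exists>zs. is_walk ?E zs \<and> hd zs = u \<and> last zs = v"
      using is_walk_join[of ?E xs "rev ys"] by (intro exI[of _ "xs @ tl (rev ys)"]) simp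
  qed
  moreover have "acyclic_graph ?E"
    unfolding acyclic_graph_def
  proof
    assume "\<exists>xs. is_cycle ?E xs"
    then obtain xs where xs: "is_cycle ?E xs" ..
    let ?m = "length xs"
    have m: "3 \<le> ?m" "distinct xs" using xs by (auto simp: is_cycle_def)
    \<comment> \<open>Indices modulo the length treat the closing edge like all others.\<close>
    have step: "{xs ! i, xs ! (Suc i mod ?m)} \<in> ?E" if "i < ?m" for i
    proof (cases "Suc i = ?m")
      case True
      then have "i = ?m - 1" by simp
      with True have "xs ! i = last xs" "xs ! (Suc i mod ?m) = hd xs"
        using m last_conv_nth[of xs] hd_conv_nth[of xs] by force+
      then show ?thesis using xs by (simp add: is_cycle_def)
    next
      case False
      with that have "Suc i < ?m" by simp
      then show ?thesis using xs by (auto simp: is_cycle_def is_walk_def successively_conv_nth)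
    qed
    obtain k where k: "k < ?m" and kmax: "\<And>i. i < ?m \<Longrightarrow> xs ! i \<le> xs ! k"
    proof -
      have "Max (set xs) \<in> set xs" using m by (intro Max_in) auto
      then show ?thesis using that by (metis List.finite_set Max_ge in_set_conv_nth nth_mem)
    qed
    \<comment> \<open>Cyclic successor and predecessor of the position of the largest vertex. Adding
      \<open>?m\<close> before subtracting 1 avoids truncated subtraction at
      \<open>k = 0\<close>.\<close>
    let ?a = "Suc k mod ?m" and ?b = "(k + ?m - 1) mod ?m"
    have b_eq: "?b = (if k = 0 then ?m - 1 else k - 1)"
    proof (cases k)
      case 0
      with m show ?thesis by simp
    next
      case (Suc k')
      then have "k + ?m - 1 = k' + ?m" by simp
      with Suc k show ?thesis by simp
    qed
    have b: "Suc ?b mod ?m = k"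
      unfolding b_eq using k m by (cases "k = 0") simp_all
    have lt: "?a < ?m" "?b < ?m"
      by (rule mod_less_divisor, use m(1) in linarith)+
    have "{xs ! ?a, xs ! k} \<in> ?E"
      using step[OF k] by (subst insert_commute)
    then have "xs ! ?a = p (xs ! k)"
      by (rule edge[OF _ kmax[OF lt(1)]])
    moreover have "{xs ! ?b, xs ! k} \<in> ?E"
      using step[OF lt(2)] by (subst (asm) b)
    then have "xs ! ?b = p (xs ! k)"
      by (rule edge[OF _ kmax[OF lt(2)]])
    ultimately have "?a = ?b"
      using nth_eq_iff_index_eq[OF m(2) lt] by simp
    moreover have "?a = (if Suc k = ?m then 0 else Suc k)"
      using k by auto
    \<comment> \<open>Successor and predecessor coincide only on cyclic lists of length at most 2,
      whereas cycles have length at least 3.\<close>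
    ultimately have "(if Suc k = ?m then 0 else Suc k) = (if k = 0 then ?m - 1 else k - 1)"
      unfolding b_eq by simp
    then show False using m(1) k by (simp split: if_splits)
  qed
  moreover have "?E \<subseteq> complete_edges {1..n}"
  proof
    fix e assume "e \<in> ?E"
    then obtain i where "i \<in> {2..n}" "e = {p i, i}" by auto
    moreover from this have "p i \<in> {1..n} \<and> i \<in> {1..n} \<and> p i \<noteq> i"
      using p[of i] by auto
    ultimately show "e \<in> complete_edges {1..n}"
      unfolding complete_edges_def by blast
  qed
  ultimately show ?thesis by (auto simp: trees_def)
qed

lemma inj_on_recursive_edges:
  assumes p: "\<And>i. i \<in> {2..n} \<Longrightarrow> p i \<in> {1..<i}"
  shows "inj_on (\<lambda>i::nat. {p i, i}) {2..n}"
proof (rule inj_onI)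
  fix i j assume ij: "i \<in> {2..n}" "j \<in> {2..n}" "{p i, i} = {p j, j}"
  then show "i = j" using p[of i] p[of j] by (auto simp: doubleton_eq_iff)
qed

section \<open>Edges as ordered pairs\<close>

text \<open>This is the index set of the random weights. Transferring tree edges to it by
  \<open>edge_pair\<close> makes a tree weight a sum of coordinates, so that monotonicity,
  measurability and the effect of changing one weight can be read off.\<close>

definition vertex_pairs :: "nat \<Rightarrow> (nat \<times> nat) set" where
  "vertex_pairs n = {(i, j). 1 \<le> i \<and> i < j \<and> j \<le> n}"

definition edge_pair :: "nat set \<Rightarrow> nat \<times> nat" where
  "edge_pair e = (Min e, Max e)"

lemma finite_vertex_pairs: "finite (vertex_pairs n)"
  by (rule finite_subset[of _ "{1..n} \<times> {1..n}"]) (auto simp: vertex_pairs_def)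

lemma card_vertex_pairs_le: "card (vertex_pairs n) \<le> n\<^sup>2"
proof -
  have "card (vertex_pairs n) \<le> card ({1..n} \<times> {1..n})"
    by (rule card_mono) (auto simp: vertex_pairs_def)
  then show ?thesis by (simp add: power2_eq_square)
qed

lemma edge_pair_doubleton: "i < j \<Longrightarrow> edge_pair {i, j} = (i, j)"
  by (simp add: edge_pair_def)

lemma edge_in_tree:
  assumes "T \<in> trees n" "e \<in> snd T"
  obtains i j where "(i, j) \<in> vertex_pairs n" "e = {i, j}"
proof -
  obtain u v where "e = {u, v}" "u \<in> {1..n}" "v \<in> {1..n}" "u \<noteq> v"
  proof -
    have "fst T \<subseteq> {1..n}" "e \<in> complete_edges (fst T)"
      using assms by (auto simp: trees_def)
    then show ?thesis using that unfolding complete_edges_def by blast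
  qed
  then have "(u, v) \<in> vertex_pairs n \<or> (v, u) \<in> vertex_pairs n" "e = {u, v}" "e = {v, u}"
    by (auto simp: vertex_pairs_def)
  then show ?thesis using that by blast
qed

lemma edge_pair_in: "T \<in> trees n \<Longrightarrow> edge_pair ` snd T \<subseteq> vertex_pairs n"
  by (auto elim!: edge_in_tree simp: vertex_pairs_def edge_pair_doubleton)

lemma inj_on_edge_pair:
  assumes "T \<in> trees n"
  shows "inj_on edge_pair (snd T)"
proof (rule inj_onI)
  have inv: "e = {fst (edge_pair e), snd (edge_pair e)}" if e: "e \<in> snd T" for e
  proof -
    obtain i j where "(i, j) \<in> vertex_pairs n" "e = {i, j}"
      using edge_in_tree[OF assms e] .
    then show ?thesis by (simp add: vertex_pairs_def edge_pair_doubleton)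
  qed
  fix e e' assume "e \<in> snd T" "e' \<in> snd T" "edge_pair e = edge_pair e'"
  then show "e = e'" using inv[of e] inv[of e'] by simp
qed

lemma card_edge_pair: "T \<in> trees n \<Longrightarrow> card (edge_pair ` snd T) = card (snd T)"
  by (intro card_image inj_on_edge_pair)

lemma tree_weight_eq:
  "T \<in> trees n \<Longrightarrow> tree_weight w T = (\<Sum>(i, j)\<in>edge_pair ` snd T. w i j)"
  unfolding tree_weight_def edge_weight_def
  by (subst sum.reindex[OF inj_on_edge_pair]) (auto simp: edge_pair_def)

lemma card_tree_edges_le: "T \<in> trees n \<Longrightarrow> card (snd T) \<le> n"
proof -
  assume T: "T \<in> trees n"
  then have "fst T \<subseteq> {1..n}" by (auto simp: trees_def)
  then have "card (fst T) \<le> n" "finite (fst T)"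
    using card_mono[of "{1..n}"] finite_subset by auto
  then show ?thesis
    using T acyclic_card_edges_le[of "fst T" "snd T"] by (auto simp: trees_def)
qed

section \<open>The minimum weight for fixed weights\<close>

lemma min_tree_weight_le:
  "T \<in> trees n \<Longrightarrow> t \<le> card (snd T) \<Longrightarrow> min_tree_weight n t w \<le> tree_weight w T"
  unfolding min_tree_weight_def using finite_trees by (intro Min_le) auto

text \<open>The star centred at vertex 1 is a witness. Without one, \<open>Min\<close> would be
  applied to the empty set and have no known value.\<close>

lemma large_trees_nonempty:
  assumes "1 \<le> n" "t \<le> n - 1"
  shows "{T \<in> trees n. t \<le> card (snd T)} \<noteq> {}"
proof -
  let ?T = "({1..n}, (\<lambda>i. {1, i}) ` {2..n})"
  have "?T \<in> trees n" using assms by (intro recursive_tree) auto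
  moreover have "card (snd ?T) = n - 1"
    using inj_on_recursive_edges[of n "\<lambda>_. 1"] by (simp add: card_image)
  ultimately have "?T \<in> {T \<in> trees n. t \<le> card (snd T)}"
    using assms by simp
  then show ?thesis by blast
qed

lemma min_tree_weight_attained:
  assumes "1 \<le> n" "t \<le> n - 1"
  obtains T where "T \<in> trees n" "t \<le> card (snd T)" "min_tree_weight n t w = tree_weight w T"
proof -
  have "min_tree_weight n t w \<in> tree_weight w ` {T \<in> trees n. t \<le> card (snd T)}"
    unfolding min_tree_weight_def using large_trees_nonempty[OF assms] finite_trees
    by (intro Min_in) auto
  then show ?thesis using that by auto
qed

text \<open>A minimal tree has at least \<open>t\<close> edges, and each one outside the light set
  weighs at least \<open>x\<close>; nonnegativity permits dropping the light ones. The difference is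
  taken in the reals and may be negative, which makes the bound linear in the number of light edges
  and ready for taking expectations.\<close>

lemma min_tree_weight_ge_light:
  assumes n: "1 \<le> n" "t \<le> n - 1" and nonneg: "\<And>i j. (i, j) \<in> vertex_pairs n \<Longrightarrow> 0 \<le> w i j"
    and x: "0 \<le> x"
  shows "x * (real t - real (card {(i, j) \<in> vertex_pairs n. w i j \<le> x})) \<le> min_tree_weight n t w"
proof -
  obtain T where T: "T \<in> trees n" "t \<le> card (snd T)" "min_tree_weight n t w = tree_weight w T"
    using min_tree_weight_attained[OF n] .
  let ?S = "edge_pair ` snd T" and ?L = "{(i, j) \<in> vertex_pairs n. w i j \<le> x}"
  have S: "?S \<subseteq> vertex_pairs n" "finite ?S" "t \<le> card ?S"
    using edge_pair_in[OF T(1)] finite_subset[OF _ finite_vertex_pairs] card_edge_pair[OF T(1)] T(2)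
    by auto
  have "card ?S - card ?L \<le> card (?S - ?L)"
    by (rule diff_card_le_card_Diff, rule finite_subset[OF _ finite_vertex_pairs[of n]]) auto
  then have "real t - real (card ?L) \<le> real (card (?S - ?L))"
    using S(3) by linarith
  then have "x * (real t - real (card ?L)) \<le> (\<Sum>(i, j)\<in>?S - ?L. x)"
    using x by (simp add: mult_left_mono case_prod_beta' mult.commute)
  also have "\<dots> \<le> (\<Sum>(i, j)\<in>?S - ?L. w i j)"
    using S(1) by (intro sum_mono) auto
  also have "\<dots> \<le> (\<Sum>(i, j)\<in>?S. w i j)"
    using S nonneg by (intro sum_mono2) auto
  finally show ?thesis using T tree_weight_eq[OF T(1)] by simp
qed

text \<open>Let \<open>p i\<close> attain the inner minimum. The resulting tree has
  \<open>n - 1\<close> edges and so competes for every admissible \<open>t\<close>.\<close>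

lemma min_tree_weight_le_recursive:
  assumes "1 \<le> n" "t \<le> n - 1"
  shows "min_tree_weight n t w \<le> (\<Sum>i=2..n. MIN j\<in>{1..<i}. w j i)"
proof -
  have "\<exists>j\<in>{1..<i}. (MIN j\<in>{1..<i}. w j i) = w j i" if "i \<in> {2..n}" for i
  proof -
    have "(MIN j\<in>{1..<i}. w j i) \<in> (\<lambda>j. w j i) ` {1..<i}"
      using that by (intro Min_in) auto
    then show ?thesis by auto
  qed
  then obtain p where p: "\<And>i. i \<in> {2..n} \<Longrightarrow> p i \<in> {1..<i} \<and> (MIN j\<in>{1..<i}. w j i) = w (p i) i"
    by metis
  let ?T = "({1..n}, (\<lambda>i. {p i, i}) ` {2..n})"
  have inj: "inj_on (\<lambda>i. {p i, i}) {2..n}"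
    using p by (intro inj_on_recursive_edges) auto
  have "?T \<in> trees n" using assms p by (intro recursive_tree) auto
  moreover have "card (snd ?T) = n - 1" using inj by (simp add: card_image)
  ultimately have "min_tree_weight n t w \<le> tree_weight w ?T"
    using assms by (intro min_tree_weight_le) auto
  also have "\<dots> = (\<Sum>i=2..n. w (p i) i)"
    unfolding tree_weight_def using inj p
    by (auto simp: sum.reindex edge_weight_def intro!: sum.cong)
  also have "\<dots> = (\<Sum>i=2..n. MIN j\<in>{1..<i}. w j i)"
    using p by (intro sum.cong) auto
  finally show ?thesis .
qed

lemma min_tree_weight_mono:
  assumes "1 \<le> n" "t \<le> n - 1" "\<And>i j. (i, j) \<in> vertex_pairs n \<Longrightarrow> w i j \<le> w' i j"
  shows "min_tree_weight n t w \<le> min_tree_weight n t w'"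
proof -
  obtain T where T: "T \<in> trees n" "t \<le> card (snd T)" "min_tree_weight n t w' = tree_weight w' T"
    using min_tree_weight_attained[OF assms(1,2)] .
  have "min_tree_weight n t w \<le> tree_weight w T"
    by (rule min_tree_weight_le[OF T(1,2)])
  also have "\<dots> \<le> tree_weight w' T"
    unfolding tree_weight_eq[OF T(1)] using edge_pair_in[OF T(1)] assms(3)
    by (intro sum_mono) auto
  finally show ?thesis using T by simp
qed

lemma min_tree_weight_cong:
  assumes "\<And>i j. (i, j) \<in> vertex_pairs n \<Longrightarrow> w i j = w' i j"
  shows "min_tree_weight n t w = min_tree_weight n t w'"
proof -
  have "tree_weight w T = tree_weight w' T" if "T \<in> trees n" for T
    unfolding tree_weight_eq[OF that] using edge_pair_in[OF that] assms
    by (intro sum.cong) auto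
  then show ?thesis
    unfolding min_tree_weight_def by (intro arg_cong[where f = Min] image_cong) auto
qed

lemma min_tree_weight_bounds:
  assumes "1 \<le> n" "t \<le> n - 1" "\<And>i j. (i, j) \<in> vertex_pairs n \<Longrightarrow> w i j \<in> {0..1}"
  shows "min_tree_weight n t w \<in> {0..real n}"
proof -
  obtain T where T: "T \<in> trees n" "min_tree_weight n t w = tree_weight w T"
    using min_tree_weight_attained[OF assms(1,2)] .
  have "w (fst e) (snd e) \<in> {0..1}" if "e \<in> edge_pair ` snd T" for e
    using edge_pair_in[OF T(1)] assms(3)[of "fst e" "snd e"] that by auto
  then have "0 \<le> tree_weight w T" "tree_weight w T \<le> real (card (edge_pair ` snd T)) * 1"
    unfolding tree_weight_eq[OF T(1)] case_prod_beta'
    by (intro sum_nonneg sum_bounded_above, simp)+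
  then show ?thesis
    using card_tree_edges_le[OF T(1)] card_edge_pair[OF T(1)] by (simp add: T(2))
qed

text \<open>Raising one weight to 1 affects the minimum only if the edge lies in a fixed minimal tree.\<close>

lemma sum_sensitivity_le:
  fixes v :: "nat \<times> nat \<Rightarrow> real"
  assumes n: "1 \<le> n" "t \<le> n - 1" and v: "\<And>e. e \<in> vertex_pairs n \<Longrightarrow> v e \<in> {0..1}"
  shows "(\<Sum>e\<in>vertex_pairs n. (min_tree_weight n t (curry v) - min_tree_weight n t (curry (v(e := 1))))\<^sup>2) \<le> real n"
proof -
  obtain T where T: "T \<in> trees n" "t \<le> card (snd T)" "min_tree_weight n t (curry v) = tree_weight (curry v) T"
    using min_tree_weight_attained[OF n] .
  let ?S = "edge_pair ` snd T"
  have S: "?S \<subseteq> vertex_pairs n" "finite ?S"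
    using edge_pair_in[OF T(1)] finite_subset[OF _ finite_vertex_pairs] by auto
  have "(min_tree_weight n t (curry v) - min_tree_weight n t (curry (v(e := 1))))\<^sup>2 \<le> (if e \<in> ?S then 1 else 0)"
    if e: "e \<in> vertex_pairs n" for e
  proof -
    have "min_tree_weight n t (curry v) \<le> min_tree_weight n t (curry (v(e := 1)))"
      using v by (intro min_tree_weight_mono n) auto
    moreover have "min_tree_weight n t (curry (v(e := 1))) \<le> tree_weight (curry (v(e := 1))) T"
      by (rule min_tree_weight_le[OF T(1,2)])
    moreover have "tree_weight (curry (v(e := 1))) T \<le> tree_weight (curry v) T + (if e \<in> ?S then 1 else 0)"
    proof -
      \<comment> \<open>Raising \<open>v e\<close> to 1 costs \<open>1 - v e\<close>, which is at
        most 1 as \<open>v e\<close> is nonnegative.\<close>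
      have "(\<Sum>d\<in>?S. (v(e := 1)) d) \<le> (\<Sum>d\<in>?S. v d + (if d = e then 1 else 0))"
        using v[OF e] by (intro sum_mono) auto
      also have "\<dots> = (\<Sum>d\<in>?S. v d) + (if e \<in> ?S then 1 else 0)"
        using S(2) by (simp add: sum.distrib)
      finally show ?thesis unfolding tree_weight_eq[OF T(1)] by (simp add: case_prod_beta')
    qed
    ultimately have "\<bar>min_tree_weight n t (curry v) - min_tree_weight n t (curry (v(e := 1)))\<bar>
        \<le> (if e \<in> ?S then 1 else 0)"
      unfolding T(3) by (simp split: if_splits)
    then show ?thesis by (auto simp: abs_square_le_1 split: if_splits)
  qed
  then have "(\<Sum>e\<in>vertex_pairs n. (min_tree_weight n t (curry v) - min_tree_weight n t (curry (v(e := 1))))\<^sup>2)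
      \<le> (\<Sum>e\<in>vertex_pairs n. if e \<in> ?S then 1 else 0)"
    by (rule sum_mono)
  also have "\<dots> = real (card ?S)"
    using S by (simp add: sum.If_cases finite_vertex_pairs Int_absorb1)
  finally show ?thesis
    using card_tree_edges_le[OF T(1)] card_edge_pair[OF T(1)] by simp
qed

lemma measurable_min_tree_weight:
  assumes "1 \<le> n" "t \<le> n - 1" "\<And>i j. (i, j) \<in> vertex_pairs n \<Longrightarrow> X (i, j) \<in> borel_measurable M"
  shows "(\<lambda>\<omega>. min_tree_weight n t (\<lambda>i j. X (i, j) \<omega>)) \<in> borel_measurable M"
proof -
  have "(\<lambda>\<omega>. tree_weight (\<lambda>i j. X (i, j) \<omega>) T) \<in> borel_measurable M" if "T \<in> trees n" for T
    unfolding tree_weight_eq[OF that] using edge_pair_in[OF that] assms(3)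
    by (intro borel_measurable_sum) (auto simp: case_prod_beta')
  then show ?thesis
    unfolding min_tree_weight_def using finite_trees large_trees_nonempty[OF assms(1,2)]
    by (intro borel_measurable_Min) auto
qed

section \<open>Analytic and probabilistic inequalities\<close>

text \<open>Weighted AM-GM inequality, obtained from the concavity of the logarithm.\<close>

lemma weighted_powr_le:
  fixes a b s :: real
  assumes "0 < a" "0 < b" "0 < s" "s < 1"
  shows "a powr (1 - s) * b powr s \<le> (1 - s) * a + s * b"
proof -
  have "concave_on {0<..} ln" by (rule ln_concave)
  then have "(1 - s) * ln a + s * ln b \<le> ln ((1 - s) *\<^sub>R a + s *\<^sub>R b)"
    using assms by (intro concave_onD) auto
  then have "exp ((1 - s) * ln a + s * ln b) \<le> exp (ln ((1 - s) * a + s * b))" by simp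
  then show ?thesis
    using assms by (simp add: powr_def exp_add add_pos_pos)
qed

text \<open>Discrete counterpart of integrating the power \<open>-s\<close> from 0 to
  \<open>n\<close>, proved by telescoping.\<close>

lemma sum_powr_minus_le:
  fixes s :: real
  assumes "0 < s" "s < 1"
  shows "(\<Sum>k=1..n. real k powr (-s)) \<le> real n powr (1 - s) / (1 - s)"
proof (induction n)
  case 0
  then show ?case using assms by simp
next
  case (Suc n)
  have "real n powr (1 - s) + (1 - s) * real (Suc n) powr (-s) \<le> real (Suc n) powr (1 - s)"
  proof (cases "n = 0")
    case False
    \<comment> \<open>AM-GM for \<open>n\<close> and \<open>n + 1\<close>: the weighted mean is
      \<open>n + s\<close>, that is \<open>(n + 1) - (1 - s)\<close>. Dividing by
      \<open>(n + 1) powr s\<close> gives the telescoping step.\<close>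
    have "real n powr (1 - s) * real (Suc n) powr s \<le> real (Suc n) - (1 - s)"
      using weighted_powr_le[of "real n" "real (Suc n)" s] False assms by (simp add: algebra_simps)
    then have "real n powr (1 - s) * real (Suc n) powr s * real (Suc n) powr (-s)
        \<le> (real (Suc n) - (1 - s)) * real (Suc n) powr (-s)"
      by (intro mult_right_mono) auto
    also have "real n powr (1 - s) * real (Suc n) powr s * real (Suc n) powr (-s) = real n powr (1 - s)"
      by (simp add: mult.assoc flip: powr_add)
    also have "(real (Suc n) - (1 - s)) * real (Suc n) powr (-s)
        = real (Suc n) powr (1 - s) - (1 - s) * real (Suc n) powr (-s)"
      by (simp add: left_diff_distrib powr_diff powr_minus field_simps)
    finally show ?thesis by simp
  qed (use assms in simp)
  then have "(real n powr (1 - s) + (1 - s) * real (Suc n) powr (-s)) / (1 - s) \<le> real (Suc n) powr (1 - s) / (1 - s)"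
    using assms by (intro divide_right_mono) auto
  with Suc.IH show ?case using assms by (simp add: add_divide_distrib)
qed

lemma exp_mult_le_chord:
  fixes t y :: real
  assumes "0 \<le> y" "y \<le> 1"
  shows "exp (t * y) \<le> 1 + (exp t - 1) * y"
proof -
  have "exp ((1 - y) *\<^sub>R 0 + y *\<^sub>R t) \<le> (1 - y) * exp 0 + y * exp t"
    using exp_convex assms by (intro convex_onD[where A = UNIV]) auto
  then show ?thesis by (simp add: algebra_simps)
qed

section \<open>Chernoff bound for sums of variables in the unit interval\<close>

context prob_space begin

text \<open>The chord bound compares each moment generating function with that of a Bernoulli
  variable of the same mean, so the number of summands does not enter. A Hoeffding bound would
  involve that number: for \<open>n\<close> summands and deviations of order
  \<open>n powr (1 - \<alpha>)\<close> its exponent has order only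
  \<open>n powr (1 - 2 * \<alpha>)\<close>.\<close>

lemma chernoff_unit_interval:
  fixes Y :: "'b \<Rightarrow> 'a \<Rightarrow> real"
  assumes fin: "finite I" and ind: "indep_vars (\<lambda>_. borel) Y I"
    and Y: "\<And>i \<omega>. i \<in> I \<Longrightarrow> \<omega> \<in> space M \<Longrightarrow> Y i \<omega> \<in> {0..1}"
    and t: "0 \<le> t"
  shows "prob {\<omega> \<in> space M. a \<le> (\<Sum>i\<in>I. Y i \<omega>)} \<le> exp ((exp t - 1) * (\<Sum>i\<in>I. expectation (Y i)) - t * a)"
proof -
  have meas[measurable]: "Y i \<in> borel_measurable M" if "i \<in> I" for i
    using ind that by (auto simp: indep_vars_def)
  have int: "integrable M (Y i)" if "i \<in> I" for i
    using Y that by (intro integrable_const_bound[where B = 1]) auto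
  have bnd: "exp (t * Y i \<omega>) \<le> 1 + (exp t - 1) * Y i \<omega>" if "i \<in> I" "\<omega> \<in> space M" for i \<omega>
    using Y[OF that] by (intro exp_mult_le_chord) auto
  have ind': "indep_vars (\<lambda>_. borel) (\<lambda>i \<omega>. exp (t * Y i \<omega>)) I"
    by (rule indep_vars_compose2[OF ind]) simp
  have int': "integrable M (\<lambda>\<omega>. exp (t * Y i \<omega>))" if "i \<in> I" for i
    using Y[OF that] t that by (intro integrable_const_bound[where B = "exp t"])
      (auto intro!: mult_left_le)
  have "expectation (\<lambda>\<omega>. exp (t * (\<Sum>i\<in>I. Y i \<omega>))) = expectation (\<lambda>\<omega>. \<Prod>i\<in>I. exp (t * Y i \<omega>))"
    using fin by (simp add: sum_distrib_left exp_sum)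
  also have "\<dots> = (\<Prod>i\<in>I. expectation (\<lambda>\<omega>. exp (t * Y i \<omega>)))"
    by (rule indep_vars_lebesgue_integral[OF fin ind' int'])
  also have "\<dots> \<le> (\<Prod>i\<in>I. exp ((exp t - 1) * expectation (Y i)))"
  proof (intro prod_mono conjI)
    fix i assume i: "i \<in> I"
    have "expectation (\<lambda>\<omega>. exp (t * Y i \<omega>)) \<le> expectation (\<lambda>\<omega>. 1 + (exp t - 1) * Y i \<omega>)"
      using bnd i by (intro integral_mono int' Bochner_Integration.integrable_add
          integrable_mult_right int) auto
    also have "\<dots> = 1 + (exp t - 1) * expectation (Y i)"
      using int[OF i] by (simp add: prob_space)
    also have "\<dots> \<le> exp ((exp t - 1) * expectation (Y i))" by (rule exp_ge_add_one_self)
    finally show "expectation (\<lambda>\<omega>. exp (t * Y i \<omega>)) \<le> exp ((exp t - 1) * expectation (Y i))" .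
  qed simp
  also have "\<dots> = exp ((exp t - 1) * (\<Sum>i\<in>I. expectation (Y i)))"
    using fin by (simp add: sum_distrib_left exp_sum)
  finally have mgf: "expectation (\<lambda>\<omega>. exp (t * (\<Sum>i\<in>I. Y i \<omega>)))
      \<le> exp ((exp t - 1) * (\<Sum>i\<in>I. expectation (Y i)))" .
  have int_exp: "integrable M (\<lambda>\<omega>. exp (t * (\<Sum>i\<in>I. Y i \<omega>)))"
    using indep_vars_integrable[OF fin ind' int'] fin by (simp add: sum_distrib_left exp_sum)
  have "prob {\<omega> \<in> space M. a \<le> (\<Sum>i\<in>I. Y i \<omega>)} \<le> prob {\<omega> \<in> space M. exp (t * a) \<le> exp (t * (\<Sum>i\<in>I. Y i \<omega>))}"
    using t by (intro finite_measure_mono) (auto intro!: mult_left_mono)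
  also have "\<dots> \<le> expectation (\<lambda>\<omega>. exp (t * (\<Sum>i\<in>I. Y i \<omega>))) / exp (t * a)"
    by (rule integral_Markov_inequality_measure[OF int_exp, where A = "{}"]) auto
  also have "\<dots> \<le> exp ((exp t - 1) * (\<Sum>i\<in>I. expectation (Y i))) / exp (t * a)"
    using mgf by (rule divide_right_mono) simp
  finally show ?thesis by (simp add: exp_diff)
qed

end

section \<open>Variance bounds on product spaces\<close>

text \<open>The two sides differ by the square of \<open>expectation X - c\<close>: the mean square
  deviation is least about the mean.\<close>

lemma (in prob_space) variance_le_about:
  fixes X :: "'a \<Rightarrow> real"
  assumes "integrable M X" "integrable M (\<lambda>x. (X x)\<^sup>2)"
  shows "expectation (\<lambda>x. (X x)\<^sup>2) - (expectation X)\<^sup>2 \<le> expectation (\<lambda>x. (X x - c)\<^sup>2)"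
proof -
  have "expectation (\<lambda>x. (X x - c)\<^sup>2) = expectation (\<lambda>x. (X x)\<^sup>2 - 2 * c * X x + c\<^sup>2)"
    by (simp add: power2_diff algebra_simps)
  also have "\<dots> = expectation (\<lambda>x. (X x)\<^sup>2) - 2 * c * expectation X + c\<^sup>2"
    using assms by (simp add: prob_space)
  finally have "expectation (\<lambda>x. (X x - c)\<^sup>2) = expectation (\<lambda>x. (X x)\<^sup>2) - 2 * c * expectation X + c\<^sup>2" .
  moreover have "0 \<le> (expectation X - c)\<^sup>2" by simp
  ultimately show ?thesis
    by (simp only: power2_diff) (simp add: algebra_simps)
qed

lemma (in prob_space) square_expectation_le:
  fixes X :: "'a \<Rightarrow> real"
  assumes "integrable M X" "integrable M (\<lambda>x. (X x)\<^sup>2)"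
  shows "(expectation X)\<^sup>2 \<le> expectation (\<lambda>x. (X x)\<^sup>2)"
  using variance_eq[OF assms] variance_positive[of X] by simp

lemma (in prob_space) integrable_bounded:
  fixes X :: "'a \<Rightarrow> real"
  assumes "X \<in> borel_measurable M" "\<And>x. x \<in> space M \<Longrightarrow> \<bar>X x\<bar> \<le> B"
  shows "integrable M X" "integrable M (\<lambda>x. (X x)\<^sup>2)"
proof -
  show "integrable M X"
    using assms by (intro integrable_const_bound[where B = B]) auto
  have "(X x)\<^sup>2 \<le> B\<^sup>2" if "x \<in> space M" for x
    using assms(2)[OF that] by (simp add: abs_le_square_iff[symmetric])
  then show "integrable M (\<lambda>x. (X x)\<^sup>2)"
    using assms(1) by (intro integrable_const_bound[where B = "B\<^sup>2"]) auto
qed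

lemma (in prob_space) abs_expectation_le:
  fixes X :: "'a \<Rightarrow> real"
  assumes "X \<in> borel_measurable M" "\<And>x. x \<in> space M \<Longrightarrow> \<bar>X x\<bar> \<le> B"
  shows "\<bar>expectation X\<bar> \<le> B"
proof -
  have "integrable M X" using integrable_bounded(1)[OF assms] .
  then have "expectation X \<le> B" "- B \<le> expectation X"
    using assms(2) by (auto intro!: integral_le_const integral_ge_const AE_I2 simp: abs_le_iff minus_le_iff)
  then show ?thesis by simp
qed

text \<open>
  Efron--Stein inequality with an arbitrary \<open>g i\<close> not depending on the \<open>i\<close>-th coordinate in place of
  the conditional expectation of \<open>f\<close> given the other coordinates.
\<close>

lemma (in product_prob_space) efron_stein:
  fixes f :: "('i \<Rightarrow> 'a) \<Rightarrow> real" and g :: "'i \<Rightarrow> ('i \<Rightarrow> 'a) \<Rightarrow> real"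
  assumes "finite J"
    and "f \<in> borel_measurable (PiM J M)" "\<And>v. v \<in> space (PiM J M) \<Longrightarrow> \<bar>f v\<bar> \<le> B"
    and "\<And>i. i \<in> J \<Longrightarrow> g i \<in> borel_measurable (PiM J M)"
    and "\<And>i v. i \<in> J \<Longrightarrow> v \<in> space (PiM J M) \<Longrightarrow> \<bar>g i v\<bar> \<le> B"
    and "\<And>i v y. i \<in> J \<Longrightarrow> v \<in> space (PiM J M) \<Longrightarrow> y \<in> space (M i) \<Longrightarrow> g i (v(i := y)) = g i v"
  shows "(\<integral>v. (f v)\<^sup>2 \<partial>PiM J M) - (\<integral>v. f v \<partial>PiM J M)\<^sup>2 \<le> (\<Sum>i\<in>J. \<integral>v. (f v - g i v)\<^sup>2 \<partial>PiM J M)"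
  using assms
proof (induction J arbitrary: f g rule: finite_induct)
  case empty
  interpret PJ: prob_space "PiM {} M" by (intro prob_space_PiM prob_space)
  define c where "c = f (\<lambda>_. undefined)"
  have c: "f v = c" if "v \<in> space (PiM {} M)" for v
    using that by (simp add: space_PiM c_def)
  have "(\<integral>v. (f v)\<^sup>2 \<partial>PiM {} M) = (\<integral>v. c\<^sup>2 \<partial>PiM {} M)" "(\<integral>v. f v \<partial>PiM {} M) = (\<integral>v. c \<partial>PiM {} M)"
    by (intro Bochner_Integration.integral_cong; simp add: c)+
  then have "(\<integral>v. (f v)\<^sup>2 \<partial>PiM {} M) = c\<^sup>2" "(\<integral>v. f v \<partial>PiM {} M) = c"
    by (simp_all add: PJ.prob_space)
  then show ?case by simp
next
  case (insert i J)
  interpret PJ: prob_space "PiM J M" by (intro prob_space_PiM prob_space)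
  interpret PI: prob_space "PiM (insert i J) M" by (intro prob_space_PiM prob_space)
  note [measurable] = insert.prems(1)
  have g[measurable]: "g j \<in> borel_measurable (PiM (insert i J) M)" if "j \<in> insert i J" for j
    using insert.prems(3) that .
  have upd: "v(i := y) \<in> space (PiM (insert i J) M)" if "v \<in> space (PiM J M)" "y \<in> space (M i)" for v y
    using that by (auto simp: space_PiM PiE_def extensional_def)
  have upd_meas[measurable]: "(\<lambda>(v, y). v(i := y)) \<in> PiM J M \<Otimes>\<^sub>M M i \<rightarrow>\<^sub>M PiM (insert i J) M"
    by (rule measurable_add_dim)
  have pair: "(\<lambda>(v, y). k (v(i := y))) \<in> borel_measurable (PiM J M \<Otimes>\<^sub>M M i)"
    if [measurable]: "k \<in> borel_measurable (PiM (insert i J) M)" for k :: "('i \<Rightarrow> 'a) \<Rightarrow> real"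
    using measurable_comp[OF upd_meas that] by (simp add: comp_def case_prod_beta')
  \<comment> \<open>Integrating out the new coordinate leaves a function on the product over
    \<open>J\<close>, where the induction hypothesis applies.\<close>
  define avg where "avg k v = (\<integral>y. k (v(i := y)) \<partial>M i)" for k :: "('i \<Rightarrow> 'a) \<Rightarrow> real" and v
  have avg_meas: "avg k \<in> borel_measurable (PiM J M)"
    if "k \<in> borel_measurable (PiM (insert i J) M)" for k
    unfolding avg_def by (rule M.borel_measurable_lebesgue_integral[OF pair[OF that]])
  have sec: "(\<lambda>y. k (v(i := y))) \<in> borel_measurable (M i)"
    if "k \<in> borel_measurable (PiM (insert i J) M)" "v \<in> space (PiM J M)" for k :: "('i \<Rightarrow> 'a) \<Rightarrow> real" and v
    using measurable_compose[OF measurable_Pair1'[OF that(2)] pair[OF that(1)]] by simp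
  have avg_bound: "\<bar>avg k v\<bar> \<le> C"
    if "k \<in> borel_measurable (PiM (insert i J) M)" "\<And>v. v \<in> space (PiM (insert i J) M) \<Longrightarrow> \<bar>k v\<bar> \<le> C"
      "v \<in> space (PiM J M)" for k v C
    unfolding avg_def using that upd sec by (intro M.abs_expectation_le) auto
  have fubini: "(\<integral>v. k v \<partial>PiM (insert i J) M) = (\<integral>v. avg k v \<partial>PiM J M)"
    if "k \<in> borel_measurable (PiM (insert i J) M)" "\<And>v. v \<in> space (PiM (insert i J) M) \<Longrightarrow> \<bar>k v\<bar> \<le> C" for k C
    unfolding avg_def using insert.hyps PI.integrable_bounded(1)[OF that]
    by (intro product_integral_insert) auto
  have sq: "\<bar>(x::real)\<^sup>2\<bar> \<le> b\<^sup>2" if "\<bar>x\<bar> \<le> b" for x b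
    using that by (simp add: abs_le_square_iff[symmetric])
  have f_bound: "\<bar>(f v)\<^sup>2\<bar> \<le> B\<^sup>2" if "v \<in> space (PiM (insert i J) M)" for v
    using insert.prems(2)[OF that] by (rule sq)
  have diff_bound: "\<bar>f v - g j v\<bar> \<le> 2 * B" "\<bar>(f v - g j v)\<^sup>2\<bar> \<le> (2 * B)\<^sup>2"
    if "j \<in> insert i J" "v \<in> space (PiM (insert i J) M)" for j v
  proof -
    show "\<bar>f v - g j v\<bar> \<le> 2 * B"
      using insert.prems(2)[OF that(2)] insert.prems(4)[OF that] by linarith
    then show "\<bar>(f v - g j v)\<^sup>2\<bar> \<le> (2 * B)\<^sup>2" by (rule sq)
  qed
  have diff_meas: "(\<lambda>v. f v - g j v) \<in> borel_measurable (PiM (insert i J) M)"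
    "(\<lambda>v. (f v - g j v)\<^sup>2) \<in> borel_measurable (PiM (insert i J) M)" if "j \<in> insert i J" for j
    using g[OF that] by measurable
  have f2_meas: "(\<lambda>v. (f v)\<^sup>2) \<in> borel_measurable (PiM (insert i J) M)" by measurable
  have avg_f: "avg f \<in> borel_measurable (PiM J M)" "\<And>v. v \<in> space (PiM J M) \<Longrightarrow> \<bar>avg f v\<bar> \<le> B"
    by (intro avg_meas avg_bound insert.prems)+
  have avg_g: "avg (g j) \<in> borel_measurable (PiM J M)"
    "\<And>v. v \<in> space (PiM J M) \<Longrightarrow> \<bar>avg (g j) v\<bar> \<le> B" if "j \<in> J" for j
    by (intro avg_meas avg_bound insert.prems insertI2 that)+
  have avg_f2_int: "integrable (PiM J M) (avg (\<lambda>v. (f v)\<^sup>2))"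
    by (intro PJ.integrable_bounded(1)[where B = "B\<^sup>2"] avg_meas avg_bound f2_meas f_bound)
  have avg_diff_int: "integrable (PiM J M) (avg (\<lambda>v. (f v - g j v)\<^sup>2))" if "j \<in> insert i J" for j
    by (intro PJ.integrable_bounded(1)[where B = "(2 * B)\<^sup>2"] avg_meas avg_bound diff_meas diff_bound that)
  have f_int: "integrable (PiM J M) (avg f)" "integrable (PiM J M) (\<lambda>v. (avg f v)\<^sup>2)"
    using PJ.integrable_bounded[OF avg_f] by auto
  \<comment> \<open>Law of total variance: the mean of the variance in coordinate \<open>i\<close>,
    plus the variance of the average over that coordinate.\<close>
  have "(\<integral>v. (f v)\<^sup>2 \<partial>PiM (insert i J) M) - (\<integral>v. f v \<partial>PiM (insert i J) M)\<^sup>2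
      = (\<integral>v. avg (\<lambda>v. (f v)\<^sup>2) v - (avg f v)\<^sup>2 \<partial>PiM J M)
        + ((\<integral>v. (avg f v)\<^sup>2 \<partial>PiM J M) - (\<integral>v. avg f v \<partial>PiM J M)\<^sup>2)"
    using fubini[OF f2_meas f_bound] fubini[OF insert.prems(1,2)] avg_f2_int f_int(2) by simp
  also have "\<dots> \<le> (\<integral>v. avg (\<lambda>v. (f v - g i v)\<^sup>2) v \<partial>PiM J M)
      + (\<Sum>j\<in>J. \<integral>v. avg (\<lambda>v. (f v - g j v)\<^sup>2) v \<partial>PiM J M)"
  proof (rule add_mono)
    show "(\<integral>v. avg (\<lambda>v. (f v)\<^sup>2) v - (avg f v)\<^sup>2 \<partial>PiM J M) \<le> (\<integral>v. avg (\<lambda>v. (f v - g i v)\<^sup>2) v \<partial>PiM J M)"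
    proof (rule integral_mono)
      fix v assume v: "v \<in> space (PiM J M)"
      \<comment> \<open>As \<open>g i\<close> ignores coordinate \<open>i\<close>, its value at any
        \<open>y0\<close> serves as the constant about which the deviation in that coordinate is
        measured.\<close>
      obtain y0 where y0: "y0 \<in> space (M i)" using M.not_empty by auto
      have "g i (v(i := y)) = g i (v(i := y0))" if "y \<in> space (M i)" for y
        using insert.prems(5)[OF insertI1 upd[OF v y0] that] by (simp only: fun_upd_upd)
      then have "avg (\<lambda>v. (f v - g i v)\<^sup>2) v = (\<integral>y. (f (v(i := y)) - g i (v(i := y0)))\<^sup>2 \<partial>M i)"
        unfolding avg_def by (intro Bochner_Integration.integral_cong) auto
      moreover have "(\<integral>y. (f (v(i := y)))\<^sup>2 \<partial>M i) - (\<integral>y. f (v(i := y)) \<partial>M i)\<^sup>2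
          \<le> (\<integral>y. (f (v(i := y)) - g i (v(i := y0)))\<^sup>2 \<partial>M i)"
        by (intro M.variance_le_about M.integrable_bounded[where B = B]
            sec[OF insert.prems(1) v] insert.prems(2) upd[OF v])
      ultimately show "avg (\<lambda>v. (f v)\<^sup>2) v - (avg f v)\<^sup>2 \<le> avg (\<lambda>v. (f v - g i v)\<^sup>2) v"
        by (simp add: avg_def)
    qed (use avg_f2_int f_int avg_diff_int in auto)
    have "(\<integral>v. (avg f v)\<^sup>2 \<partial>PiM J M) - (\<integral>v. avg f v \<partial>PiM J M)\<^sup>2
        \<le> (\<Sum>j\<in>J. \<integral>v. (avg f v - avg (g j) v)\<^sup>2 \<partial>PiM J M)"
    proof (rule insert.IH)
      fix j v y assume j: "j \<in> J" and v: "v \<in> space (PiM J M)" and y: "y \<in> space (M j)"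
      have ij: "i \<noteq> j" using j insert.hyps by auto
      show "avg (g j) (v(j := y)) = avg (g j) v"
        unfolding avg_def
      proof (rule Bochner_Integration.integral_cong)
        fix z assume z: "z \<in> space (M i)"
        show "g j (v(j := y, i := z)) = g j (v(i := z))"
          unfolding fun_upd_twist[OF ij[symmetric]]
          by (rule insert.prems(5)[OF insertI2[OF j] upd[OF v z] y])
      qed simp
    qed (fact avg_f avg_g)+
    \<comment> \<open>Jensen's inequality in coordinate \<open>i\<close>: the square of an average
      is at most the average of the squares.\<close>
    also have "\<dots> \<le> (\<Sum>j\<in>J. \<integral>v. avg (\<lambda>v. (f v - g j v)\<^sup>2) v \<partial>PiM J M)"
    proof (rule sum_mono)
      fix j assume j: "j \<in> J"
      then have j': "j \<in> insert i J" by simp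
      show "(\<integral>v. (avg f v - avg (g j) v)\<^sup>2 \<partial>PiM J M) \<le> (\<integral>v. avg (\<lambda>v. (f v - g j v)\<^sup>2) v \<partial>PiM J M)"
      proof (rule integral_mono)
        have "\<bar>avg f v - avg (g j) v\<bar> \<le> 2 * B" if "v \<in> space (PiM J M)" for v
          using avg_f(2)[OF that] avg_g(2)[OF j that] by linarith
        then show "integrable (PiM J M) (\<lambda>v. (avg f v - avg (g j) v)\<^sup>2)"
          using avg_f(1) avg_g(1)[OF j] by (intro PJ.integrable_bounded(2)) auto
        fix v assume v: "v \<in> space (PiM J M)"
        have "avg f v - avg (g j) v = (\<integral>y. f (v(i := y)) - g j (v(i := y)) \<partial>M i)"
          unfolding avg_def
          by (intro Bochner_Integration.integral_diff[symmetric] M.integrable_bounded(1)[where B = B]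
              sec[OF insert.prems(1) v] sec[OF g[OF j'] v] insert.prems(2) insert.prems(4)[OF j'] upd[OF v])
        also have "\<dots>\<^sup>2 \<le> avg (\<lambda>v. (f v - g j v)\<^sup>2) v"
          unfolding avg_def
          by (intro M.square_expectation_le M.integrable_bounded[where B = "2 * B"]
              sec[OF diff_meas(1)[OF j'] v] diff_bound(1)[OF j'] upd[OF v])
        finally show "(avg f v - avg (g j) v)\<^sup>2 \<le> avg (\<lambda>v. (f v - g j v)\<^sup>2) v" .
      qed (use avg_diff_int j' in auto)
    qed
    finally show "(\<integral>v. (avg f v)\<^sup>2 \<partial>PiM J M) - (\<integral>v. avg f v \<partial>PiM J M)\<^sup>2
        \<le> (\<Sum>j\<in>J. \<integral>v. avg (\<lambda>v. (f v - g j v)\<^sup>2) v \<partial>PiM J M)" .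
  qed
  also have "\<dots> = (\<Sum>j\<in>insert i J. \<integral>v. (f v - g j v)\<^sup>2 \<partial>PiM (insert i J) M)"
  proof -
    have "(\<integral>v. (f v - g j v)\<^sup>2 \<partial>PiM (insert i J) M) = (\<integral>v. avg (\<lambda>v. (f v - g j v)\<^sup>2) v \<partial>PiM J M)"
      if "j \<in> insert i J" for j
      using fubini[OF diff_meas(2)[OF that] diff_bound(2)[OF that]] .
    then show ?thesis using insert.hyps by simp
  qed
  finally show ?case .
qed

section \<open>Random weights\<close>

text \<open>Layer-cake sum with step width \<open>a\<close>: a value of \<open>Z\<close> is at most
  \<open>a\<close> times the number of multiples of \<open>a\<close>, counted from 0, that lie
  strictly below it. Tails are required only up to level 1, since the distribution functions are
  controlled only up to there.\<close>

lemma (in prob_space) expectation_le_of_geometric_tail: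
  fixes Z :: "'a \<Rightarrow> real"
  assumes [measurable]: "Z \<in> borel_measurable M"
    and Z: "\<And>\<omega>. \<omega> \<in> space M \<Longrightarrow> Z \<omega> \<in> {0..1}"
    and a: "0 < a" and q: "0 \<le> q" "q < 1"
    and tail: "\<And>k. real k * a \<le> 1 \<Longrightarrow> prob {\<omega> \<in> space M. real k * a < Z \<omega>} \<le> q ^ k"
  shows "expectation Z \<le> a / (1 - q)"
proof -
  define K where "K = nat \<lceil>1 / a\<rceil>"
  let ?A = "\<lambda>k. {\<omega> \<in> space M. real k * a < Z \<omega>}"
  have le: "Z \<omega> \<le> (\<Sum>k<K. a * indicator (?A k) \<omega>)" if \<omega>: "\<omega> \<in> space M" for \<omega>
  proof -
    define l where "l = nat \<lceil>Z \<omega> / a\<rceil>"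
    have "l \<le> K"
      unfolding l_def K_def using Z[OF \<omega>] a by (intro nat_mono ceiling_mono divide_right_mono) auto
    have "Z \<omega> / a \<le> real l" unfolding l_def by linarith
    then have "Z \<omega> \<le> (\<Sum>k<l. a)" using a by (simp add: field_simps)
    also have "\<dots> = (\<Sum>k<l. a * indicator (?A k) \<omega>)"
    proof (rule sum.cong)
      fix k assume "k \<in> {..<l}"
      then have "real k < Z \<omega> / a" unfolding l_def by (simp add: zless_nat_eq_int_zless less_ceiling_iff)
      then show "a = a * indicator (?A k) \<omega>" using \<omega> a by (simp add: field_simps)
    qed simp
    also have "\<dots> \<le> (\<Sum>k<K. a * indicator (?A k) \<omega>)"
      using \<open>l \<le> K\<close> a by (intro sum_mono2) auto
    finally show ?thesis .
  qed
  have "expectation Z \<le> expectation (\<lambda>\<omega>. \<Sum>k<K. a * indicator (?A k) \<omega>)"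
    using Z le by (intro integral_mono integrable_const_bound[where B = 1] Bochner_Integration.integrable_sum
        integrable_mult_right integrable_real_indicator) (auto simp: emeasure_eq_measure)
  also have "\<dots> = a * (\<Sum>k<K. prob (?A k))"
    by (subst Bochner_Integration.integral_sum) (auto simp: sum_distrib_left emeasure_eq_measure)
  also have "\<dots> \<le> a * (\<Sum>k<K. q ^ k)"
  proof (intro mult_left_mono sum_mono tail)
    fix k assume "k \<in> {..<K}"
    then have "real k < 1 / a" unfolding K_def by (simp add: zless_nat_eq_int_zless less_ceiling_iff)
    then show "real k * a \<le> 1" using a by (simp add: field_simps)
  qed (use a in auto)
  also have "\<dots> \<le> a * (1 / (1 - q))"
    using q a by (intro mult_left_mono) (auto simp: sum_gp_strict intro: divide_right_mono)
  finally show ?thesis by simp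
qed

text \<open>There are at most \<open>n^2\<close> pairs, each light with probability at most
  \<open>\<delta> / n\<close>, so the mean count is at most \<open>\<delta> * n\<close>. The tail is
  the Chernoff bound for the indicators, with \<open>exp s - 1\<close> relaxed to
  \<open>exp s\<close>.\<close>

lemma (in prob_space)
  fixes X :: "nat \<times> nat \<Rightarrow> 'a \<Rightarrow> real"
  assumes ind: "indep_vars (\<lambda>_. borel) X (vertex_pairs n)"
    and n: "1 \<le> n" and \<delta>: "0 \<le> \<delta>"
    and light: "\<And>e. e \<in> vertex_pairs n \<Longrightarrow> prob {\<omega> \<in> space M. X e \<omega> \<le> x} \<le> \<delta> / real n"
  shows light_edges_tail: "0 \<le> s \<Longrightarrow>
      prob {\<omega> \<in> space M. a \<le> real (card {(i, j) \<in> vertex_pairs n. X (i, j) \<omega> \<le> x})} \<le> exp (exp s * \<delta> * real n - s * a)"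
    and light_edges_expectation:
      "expectation (\<lambda>\<omega>. real (card {(i, j) \<in> vertex_pairs n. X (i, j) \<omega> \<le> x})) \<le> \<delta> * real n"
    and light_edges_measurable:
      "(\<lambda>\<omega>. real (card {(i, j) \<in> vertex_pairs n. X (i, j) \<omega> \<le> x})) \<in> borel_measurable M"
proof -
  define Y where "Y e \<omega> = (indicator {..x} (X e \<omega>) :: real)" for e \<omega>
  have X_meas: "X e \<in> borel_measurable M" if "e \<in> vertex_pairs n" for e
    using ind that by (auto simp: indep_vars_def)
  have Y_meas: "Y e \<in> borel_measurable M" if "e \<in> vertex_pairs n" for e
    unfolding Y_def using X_meas[OF that] by measurable
  have card_eq: "real (card {(i, j) \<in> vertex_pairs n. X (i, j) \<omega> \<le> x}) = (\<Sum>e\<in>vertex_pairs n. Y e \<omega>)" for \<omega>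
  proof -
    have "{(i, j) \<in> vertex_pairs n. X (i, j) \<omega> \<le> x} = vertex_pairs n \<inter> {e. X e \<omega> \<le> x}" by auto
    then show ?thesis
      by (simp add: Y_def indicator_def sum.If_cases finite_vertex_pairs)
  qed
  have Y_exp: "expectation (Y e) = prob {\<omega> \<in> space M. X e \<omega> \<le> x}" if "e \<in> vertex_pairs n" for e
  proof -
    have "expectation (Y e) = expectation (indicator {\<omega> \<in> space M. X e \<omega> \<le> x})"
      by (intro Bochner_Integration.integral_cong) (auto simp: Y_def indicator_def)
    also have "\<dots> = prob ({\<omega> \<in> space M. X e \<omega> \<le> x} \<inter> space M)" by simp
    finally show ?thesis by (simp add: Int_absorb2)
  qed
  have "(\<Sum>e\<in>vertex_pairs n. expectation (Y e)) \<le> real (card (vertex_pairs n)) * (\<delta> / real n)"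
    using light by (intro sum_bounded_above) (simp add: Y_exp)
  also have "\<dots> \<le> (real n)\<^sup>2 * (\<delta> / real n)"
    using card_vertex_pairs_le[of n] \<delta> by (intro mult_right_mono) (auto simp flip: of_nat_power)
  also have "\<dots> = \<delta> * real n"
    using n by (simp add: power2_eq_square)
  finally have sum_le: "(\<Sum>e\<in>vertex_pairs n. expectation (Y e)) \<le> \<delta> * real n" .
  have Y_int: "integrable M (Y e)" if "e \<in> vertex_pairs n" for e
    using Y_meas[OF that] by (intro integrable_bounded(1)[where B = 1]) (auto simp: Y_def indicator_def)
  show "expectation (\<lambda>\<omega>. real (card {(i, j) \<in> vertex_pairs n. X (i, j) \<omega> \<le> x})) \<le> \<delta> * real n"
    unfolding card_eq using sum_le Y_int by (simp add: Bochner_Integration.integral_sum)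
  show "(\<lambda>\<omega>. real (card {(i, j) \<in> vertex_pairs n. X (i, j) \<omega> \<le> x})) \<in> borel_measurable M"
    unfolding card_eq by (intro borel_measurable_sum Y_meas)
  assume s: "0 \<le> s"
  have "indep_vars (\<lambda>_. borel) Y (vertex_pairs n)"
    unfolding Y_def by (rule indep_vars_compose2[OF ind]) simp
  then have "prob {\<omega> \<in> space M. a \<le> (\<Sum>e\<in>vertex_pairs n. Y e \<omega>)}
      \<le> exp ((exp s - 1) * (\<Sum>e\<in>vertex_pairs n. expectation (Y e)) - s * a)"
    by (rule chernoff_unit_interval[OF finite_vertex_pairs _ _ s]) (simp add: Y_def indicator_def)
  also have "\<dots> \<le> exp (exp s * \<delta> * real n - s * a)"
  proof -
    have "(exp s - 1) * (\<Sum>e\<in>vertex_pairs n. expectation (Y e)) \<le> exp s * (\<delta> * real n)"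
      using s sum_le \<delta> by (intro mult_mono) (auto intro!: sum_nonneg simp: Y_exp)
    then show ?thesis by (simp add: mult.assoc)
  qed
  finally show "prob {\<omega> \<in> space M. a \<le> real (card {(i, j) \<in> vertex_pairs n. X (i, j) \<omega> \<le> x})}
      \<le> exp (exp s * \<delta> * real n - s * a)"
    unfolding card_eq .
qed
  

section \<open>Variance of the minimum weight\<close>

lemma (in prob_space) variance_min_tree_weight_le:
  fixes X :: "nat \<times> nat \<Rightarrow> 'a \<Rightarrow> real"
  assumes n: "2 \<le> n" "t \<le> n - 1"
    and ind: "indep_vars (\<lambda>_. borel) X (vertex_pairs n)"
    and X01: "\<And>e \<omega>. e \<in> vertex_pairs n \<Longrightarrow> \<omega> \<in> space M \<Longrightarrow> X e \<omega> \<in> {0..1}"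
  shows "variance (\<lambda>\<omega>. min_tree_weight n t (\<lambda>i j. X (i, j) \<omega>)) \<le> real n"
proof -
  let ?I = "vertex_pairs n"
  \<comment> \<open>A product of probability spaces wants a probability measure at every index; a
    point mass fills the indices that are not vertex pairs.\<close>
  define N where "N e = (if e \<in> ?I then distr M borel (X e) else return borel 0)" for e
  \<comment> \<open>On the product space points may have coordinates outside the unit interval.
    Clamping bounds \<open>f\<close> everywhere without changing it on the values taken by the
    weights.\<close>
  define clamp where "clamp v e = max 0 (min 1 (v e))" for v :: "nat \<times> nat \<Rightarrow> real" and e
  define f where "f v = min_tree_weight n t (curry (clamp v))" for v
  define g where "g e v = f (v(e := 1))" for e v
  have n1: "1 \<le> n" using n by simp
  have X_meas: "X e \<in> borel_measurable M" if "e \<in> ?I" for e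
    using ind that by (auto simp: indep_vars_def)
  have N_prob: "prob_space (N e)" for e
    by (auto simp: N_def X_meas intro: prob_space_distr prob_space_return)
  interpret N: product_prob_space N ?I
    by (rule product_prob_spaceI[OF N_prob])
  have PN: "prob_space (PiM ?I N)"
    by (intro prob_space_PiM N_prob)
  have "(1, 2) \<in> ?I" using n by (simp add: vertex_pairs_def)
  then have "?I \<noteq> {}" by blast
  have "distr M (PiM ?I (\<lambda>_. borel)) (\<lambda>\<omega>. \<lambda>e\<in>?I. X e \<omega>) = PiM ?I (\<lambda>e. distr M borel (X e))"
    using ind indep_vars_iff_distr_eq_PiM'[where I = ?I and M' = "\<lambda>_. borel" and X = X] \<open>?I \<noteq> {}\<close> X_meas by blast
  also have "\<dots> = PiM ?I N" by (intro PiM_cong) (auto simp: N_def)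
  finally have distr_eq: "distr M (PiM ?I (\<lambda>_. borel)) (\<lambda>\<omega>. \<lambda>e\<in>?I. X e \<omega>) = PiM ?I N" .
  have sets_N: "sets (PiM ?I N) = sets (PiM ?I (\<lambda>_. borel))"
    by (intro sets_PiM_cong) (auto simp: N_def)
  have X_rv: "(\<lambda>\<omega>. \<lambda>e\<in>?I. X e \<omega>) \<in> M \<rightarrow>\<^sub>M PiM ?I (\<lambda>_. borel)"
    by (intro measurable_restrict X_meas)
  have comp_meas: "(\<lambda>v. v e) \<in> borel_measurable (PiM ?I N)" if "e \<in> ?I" for e
    unfolding measurable_cong_sets[OF sets_N refl] using that by (rule measurable_component_singleton)
  have f_meas: "f \<in> borel_measurable (PiM ?I N)"
    unfolding f_def curry_def using comp_meas
    by (intro measurable_min_tree_weight[OF n1 n(2)]) (auto simp: clamp_def)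
  have g_meas: "g d \<in> borel_measurable (PiM ?I N)" for d
    unfolding g_def f_def curry_def
  proof (intro measurable_min_tree_weight[OF n1 n(2)])
    fix i j assume "(i, j) \<in> ?I"
    then show "(\<lambda>v. clamp (v(d := 1)) (i, j)) \<in> borel_measurable (PiM ?I N)"
      using comp_meas by (cases "(i, j) = d") (auto simp: clamp_def)
  qed
  have clamp01: "clamp v e \<in> {0..1}" for v e by (simp add: clamp_def)
  have f_bound: "\<bar>f v\<bar> \<le> real n" for v
    using min_tree_weight_bounds[OF n1 n(2), of "curry (clamp v)"] clamp01 by (simp add: f_def)
  have g_bound: "\<bar>g d v\<bar> \<le> real n" for d v
    unfolding g_def by (rule f_bound)
  have diff_bound: "\<bar>f v - g e v\<bar> \<le> 2 * real n" for e v
    using f_bound[of v] g_bound[of e v] by linarith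
  have diff_int: "integrable (PiM ?I N) (\<lambda>v. (f v - g e v)\<^sup>2)" for e
    by (rule prob_space.integrable_bounded(2)[OF PN borel_measurable_diff[OF f_meas g_meas] diff_bound])
  have push: "(\<integral>\<omega>. h (\<lambda>e\<in>?I. X e \<omega>) \<partial>M) = (\<integral>v. h v \<partial>PiM ?I N)"
    if "h \<in> borel_measurable (PiM ?I N)" for h :: "(nat \<times> nat \<Rightarrow> real) \<Rightarrow> real"
  proof -
    have "h \<in> borel_measurable (PiM ?I (\<lambda>_. borel))"
      using that by (simp add: measurable_cong_sets[OF sets_N refl])
    then show ?thesis
      unfolding distr_eq[symmetric] by (rule integral_distr[OF X_rv, symmetric])
  qed
  let ?W = "\<lambda>\<omega>. min_tree_weight n t (\<lambda>i j. X (i, j) \<omega>)"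
  have W_eq: "?W \<omega> = f (\<lambda>e\<in>?I. X e \<omega>)" if "\<omega> \<in> space M" for \<omega>
    unfolding f_def using X01[OF _ that] by (intro min_tree_weight_cong) (simp add: clamp_def)
  have W_meas: "?W \<in> borel_measurable M"
    using X_meas by (intro measurable_min_tree_weight[OF n1 n(2)])
  have W_bound: "\<bar>?W \<omega>\<bar> \<le> real n" if "\<omega> \<in> space M" for \<omega>
    using f_bound W_eq[OF that] by simp
  have W_int: "integrable M ?W" "integrable M (\<lambda>\<omega>. (?W \<omega>)\<^sup>2)"
    by (rule integrable_bounded[OF W_meas W_bound], assumption)+
  have E1: "expectation ?W = (\<integral>v. f v \<partial>PiM ?I N)"
    unfolding push[OF f_meas, symmetric] by (intro Bochner_Integration.integral_cong W_eq) simp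
  have E2: "expectation (\<lambda>\<omega>. (?W \<omega>)\<^sup>2) = (\<integral>v. (f v)\<^sup>2 \<partial>PiM ?I N)"
    using f_meas W_eq
    by (subst push[symmetric]) (auto intro!: Bochner_Integration.integral_cong)
  have "variance ?W = (\<integral>v. (f v)\<^sup>2 \<partial>PiM ?I N) - (\<integral>v. f v \<partial>PiM ?I N)\<^sup>2"
    using variance_eq[OF W_int] unfolding E1 E2 .
  also have "(\<integral>v. (f v)\<^sup>2 \<partial>PiM ?I N) - (\<integral>v. f v \<partial>PiM ?I N)\<^sup>2
      \<le> (\<Sum>e\<in>?I. \<integral>v. (f v - g e v)\<^sup>2 \<partial>PiM ?I N)"
    by (intro N.efron_stein[where B = "real n"] finite_vertex_pairs f_meas g_meas f_bound g_bound) (simp add: g_def)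
  also have "\<dots> = (\<integral>v. (\<Sum>e\<in>?I. (f v - g e v)\<^sup>2) \<partial>PiM ?I N)"
    using diff_int by (intro Bochner_Integration.integral_sum[symmetric]) auto
  also have "\<dots> \<le> real n"
  proof (intro prob_space.integral_le_const[OF PN] Bochner_Integration.integrable_sum diff_int AE_I2)
    fix v :: "nat \<times> nat \<Rightarrow> real"
    \<comment> \<open>Since 1 lies in the unit interval, clamping commutes with the modification,
      and the deterministic estimate applies at every point under the integral.\<close>
    have "clamp (v(e := 1)) = (clamp v)(e := 1)" for e by (auto simp: clamp_def)
    then show "(\<Sum>e\<in>?I. (f v - g e v)\<^sup>2) \<le> real n"
      using sum_sensitivity_le[OF n1 n(2), of "clamp v"] clamp01 by (simp add: f_def g_def)
  qed
  finally show ?thesis .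
qed

section \<open>Cheapest edges to earlier vertices\<close>

lemma (in prob_space) indep_vars_best_edge:
  fixes X :: "nat \<times> nat \<Rightarrow> 'a \<Rightarrow> real"
  assumes "indep_vars (\<lambda>_. borel) X (vertex_pairs n)"
  shows "indep_vars (\<lambda>_. borel) (\<lambda>i \<omega>. MIN j\<in>{1..<i}. X (j, i) \<omega>) {2..n}"
proof -
  let ?K = "\<lambda>i::nat. (\<lambda>j. (j, i)) ` {1..<i}"
  have "indep_vars (\<lambda>i. PiM (?K i) (\<lambda>_. borel)) (\<lambda>i \<omega>. restrict (\<lambda>e. X e \<omega>) (?K i)) {2..n}"
    by (rule indep_vars_restrict[OF assms])
      (auto simp: vertex_pairs_def disjoint_family_on_def)
  then have "indep_vars (\<lambda>_. borel)
      (\<lambda>i \<omega>. (\<lambda>v. MIN j\<in>{1..<i}. v (j, i)) (restrict (\<lambda>e. X e \<omega>) (?K i))) {2..n}"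
  proof (rule indep_vars_compose2)
    fix i
    show "(\<lambda>v. MIN j\<in>{1..<i}. v (j, i)) \<in> borel_measurable (PiM (?K i) (\<lambda>_. borel :: real measure))"
      by (intro borel_measurable_Min measurable_component_singleton) auto
  qed
  moreover have "(MIN j\<in>{1..<i}. restrict (\<lambda>e. X e \<omega>) (?K i) (j, i)) = (MIN j\<in>{1..<i}. X (j, i) \<omega>)" for i \<omega>
    by (intro arg_cong[where f = Min] image_cong) auto
  ultimately show ?thesis by simp
qed

text \<open>The minimum exceeds \<open>y\<close> exactly when all \<open>i - 1\<close> weights do;
  these are independent events, each of probability at most \<open>1 - p\<close>, hence at most
  \<open>exp (- p)\<close>.\<close>

lemma (in prob_space) best_edge_tail:
  fixes X :: "nat \<times> nat \<Rightarrow> 'a \<Rightarrow> real"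
  assumes ind: "indep_vars (\<lambda>_. borel) X (vertex_pairs n)"
    and p: "0 \<le> p" "\<And>e. e \<in> vertex_pairs n \<Longrightarrow> p \<le> prob {\<omega> \<in> space M. X e \<omega> \<le> y}"
    and i: "i \<in> {2..n}"
  shows "prob {\<omega> \<in> space M. y < (MIN j\<in>{1..<i}. X (j, i) \<omega>)} \<le> exp (- p * real (i - 1))"
proof -
  let ?K = "(\<lambda>j. (j, i)) ` {1..<i}"
  let ?A = "\<lambda>e. X e -` {y<..} \<inter> space M"
  have K: "?K \<subseteq> vertex_pairs n" "?K \<noteq> {}" "finite ?K" "card ?K = i - 1"
    using i by (auto simp: vertex_pairs_def card_image inj_on_def)
  have X_meas: "X e \<in> borel_measurable M" if "e \<in> vertex_pairs n" for e
    using ind that by (auto simp: indep_vars_def)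
  have "{\<omega> \<in> space M. y < (MIN j\<in>{1..<i}. X (j, i) \<omega>)} = (\<Inter>e\<in>?K. ?A e)"
    using i by (auto simp: Min_gr_iff)
  also have "prob \<dots> = (\<Prod>e\<in>?K. prob (?A e))"
  proof (rule indep_setsD[OF _ K(1-3)])
    show "indep_sets (\<lambda>e. {X e -` A \<inter> space M |A. A \<in> sets borel}) (vertex_pairs n)"
      using ind by (simp add: indep_vars_def2)
    show "\<forall>e\<in>?K. ?A e \<in> {X e -` A \<inter> space M |A. A \<in> sets borel}"
      by (intro ballI CollectI exI[of _ "{y<..}"]) simp
  qed
  also have "\<dots> \<le> (\<Prod>e\<in>?K. exp (- p))"
  proof (intro prod_mono conjI)
    fix e assume "e \<in> ?K"
    then have e: "e \<in> vertex_pairs n" using K(1) by auto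
    have "?A e = space M - {\<omega> \<in> space M. X e \<omega> \<le> y}" by auto
    then have "prob (?A e) = 1 - prob {\<omega> \<in> space M. X e \<omega> \<le> y}"
      using X_meas[OF e] by (simp add: prob_compl)
    also have "\<dots> \<le> 1 - p" using p(2)[OF e] by simp
    also have "\<dots> \<le> exp (- p)" using exp_ge_add_one_self[of "- p"] by simp
    finally show "prob (?A e) \<le> exp (- p)" .
  qed simp
  also have "\<dots> = exp (- p * real (i - 1))"
    using K(4) by (simp add: exp_of_nat_mult[symmetric] mult.commute)
  finally show ?thesis .
qed

lemma (in prob_space) best_edge_expectation:
  fixes X :: "nat \<times> nat \<Rightarrow> 'a \<Rightarrow> real"
  assumes ind: "indep_vars (\<lambda>_. borel) X (vertex_pairs n)"
    and X01: "\<And>e \<omega>. e \<in> vertex_pairs n \<Longrightarrow> \<omega> \<in> space M \<Longrightarrow> X e \<omega> \<in> {0..1}"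
    and \<alpha>: "0 < \<alpha>" "\<alpha> < 1" and D: "0 < D"
    and cdf: "\<And>e x. e \<in> vertex_pairs n \<Longrightarrow> 0 \<le> x \<Longrightarrow> x \<le> 1 \<Longrightarrow>
      D * x powr (1 / \<alpha>) \<le> prob {\<omega> \<in> space M. X e \<omega> \<le> x}"
    and i: "i \<in> {2..n}"
  shows "expectation (\<lambda>\<omega>. MIN j\<in>{1..<i}. X (j, i) \<omega>) \<le> real (i - 1) powr (- \<alpha>) / (1 - exp (- D))"
proof (rule expectation_le_of_geometric_tail)
  show "(\<lambda>\<omega>. MIN j\<in>{1..<i}. X (j, i) \<omega>) \<in> borel_measurable M"
    using indep_vars_best_edge[OF ind] i by (auto simp: indep_vars_def)
  fix \<omega> assume \<omega>: "\<omega> \<in> space M"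
  have "(MIN j\<in>{1..<i}. X (j, i) \<omega>) \<in> (\<lambda>j. X (j, i) \<omega>) ` {1..<i}"
    using i by (intro Min_in) auto
  then obtain j where "(MIN j\<in>{1..<i}. X (j, i) \<omega>) = X (j, i) \<omega>" "j \<in> {1..<i}"
    by blast
  then show "(MIN j\<in>{1..<i}. X (j, i) \<omega>) \<in> {0..1}"
    using X01[OF _ \<omega>, of "(j, i)"] i by (simp add: vertex_pairs_def)
next
  fix k :: nat
  \<comment> \<open>The natural scale of a minimum of \<open>i - 1\<close> weights:
    \<open>a powr (1 / \<alpha>)\<close> is the reciprocal of \<open>i - 1\<close>, which cancels
    the exponent in the tail bound.\<close>
  define a where "a = real (i - 1) powr (- \<alpha>)"
  assume "real k * real (i - 1) powr (- \<alpha>) \<le> 1"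
  then have k: "real k * a \<le> 1" by (simp add: a_def)
  let ?p = "D * (real k * a) powr (1 / \<alpha>)"
  have "a powr (1 / \<alpha>) = real (i - 1) powr (- 1)"
    unfolding a_def powr_powr using \<alpha> by simp
  then have a: "a powr (1 / \<alpha>) * real (i - 1) = 1"
    using i by (simp add: powr_minus)
  have "(real k * a) powr (1 / \<alpha>) = real k powr (1 / \<alpha>) * a powr (1 / \<alpha>)"
    by (rule powr_mult)
  then have "?p * real (i - 1) = D * real k powr (1 / \<alpha>) * (a powr (1 / \<alpha>) * real (i - 1))"
    by (simp only: mult_ac)
  also have "\<dots> = D * real k powr (1 / \<alpha>)"
    by (simp only: a mult_1_right)
  finally have "?p * real (i - 1) = D * real k powr (1 / \<alpha>)" .
  \<comment> \<open>The exponent \<open>1 / \<alpha>\<close> exceeds 1 and \<open>k\<close> is a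
    natural number, so the tail at \<open>k * a\<close> is geometric in \<open>k\<close> with ratio
    \<open>exp (- D)\<close>.\<close>
  moreover have "real k \<le> real k powr (1 / \<alpha>)"
    using powr_mono[of 1 "1 / \<alpha>" "real k"] \<alpha> by (cases "k = 0") auto
  ultimately have "D * real k \<le> ?p * real (i - 1)"
    using D by simp
  moreover have "prob {\<omega> \<in> space M. real k * a < (MIN j\<in>{1..<i}. X (j, i) \<omega>)} \<le> exp (- ?p * real (i - 1))"
    using D k by (intro best_edge_tail[OF ind _ _ i] cdf) (auto simp: a_def)
  ultimately have "prob {\<omega> \<in> space M. real k * a < (MIN j\<in>{1..<i}. X (j, i) \<omega>)} \<le> exp (- (D * real k))"
    by (elim order_trans) simp
  also have "\<dots> = exp (- D) ^ k"
    by (simp add: exp_of_nat_mult[symmetric] mult.commute)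
  finally show "prob {\<omega> \<in> space M. real k * real (i - 1) powr (- \<alpha>) < (MIN j\<in>{1..<i}. X (j, i) \<omega>)} \<le> exp (- D) ^ k"
    by (simp add: a_def)
qed (use i D in auto)

text \<open>In the constant, \<open>1 - exp (- D)\<close> comes from the geometric series for a
  single edge and \<open>1 - \<alpha>\<close> from summing the powers of
  \<open>i - 1\<close>.\<close>

lemma (in prob_space) recursive_tree_weight_expectation:
  fixes X :: "nat \<times> nat \<Rightarrow> 'a \<Rightarrow> real"
  assumes ind: "indep_vars (\<lambda>_. borel) X (vertex_pairs n)"
    and X01: "\<And>e \<omega>. e \<in> vertex_pairs n \<Longrightarrow> \<omega> \<in> space M \<Longrightarrow> X e \<omega> \<in> {0..1}"
    and \<alpha>: "0 < \<alpha>" "\<alpha> < 1" and D: "0 < D"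
    and cdf: "\<And>e x. e \<in> vertex_pairs n \<Longrightarrow> 0 \<le> x \<Longrightarrow> x \<le> 1 \<Longrightarrow>
      D * x powr (1 / \<alpha>) \<le> prob {\<omega> \<in> space M. X e \<omega> \<le> x}"
  shows "(\<Sum>i=2..n. expectation (\<lambda>\<omega>. MIN j\<in>{1..<i}. X (j, i) \<omega>))
    \<le> 1 / ((1 - exp (- D)) * (1 - \<alpha>)) * real n powr (1 - \<alpha>)"
proof -
  have "(\<Sum>i=2..n. expectation (\<lambda>\<omega>. MIN j\<in>{1..<i}. X (j, i) \<omega>))
      \<le> (\<Sum>i=2..n. real (i - 1) powr (- \<alpha>) / (1 - exp (- D)))"
    by (intro sum_mono best_edge_expectation[OF ind X01 \<alpha> D cdf])
  also have "\<dots> = (\<Sum>k=1..n - 1. real k powr (- \<alpha>)) / (1 - exp (- D))"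
    unfolding sum_divide_distrib
    by (rule sum.reindex_bij_witness[of _ Suc "\<lambda>i. i - 1"]) auto
  also have "\<dots> \<le> real (n - 1) powr (1 - \<alpha>) / (1 - \<alpha>) / (1 - exp (- D))"
    using sum_powr_minus_le[OF \<alpha>, of "n - 1"] D by (intro divide_right_mono) auto
  also have "\<dots> \<le> real n powr (1 - \<alpha>) / (1 - \<alpha>) / (1 - exp (- D))"
    using D \<alpha> by (intro divide_right_mono powr_mono2) auto
  finally show ?thesis by (simp add: mult.commute)
qed

section \<open>Order of magnitude of the minimum weight\<close>

lemma (in prob_space) min_tree_weight_order:
  fixes X :: "nat \<times> nat \<Rightarrow> 'a \<Rightarrow> real" and \<rho> \<alpha> D1 D2 c B :: real
  assumes n: "2 \<le> n" "t \<le> n - 1" "\<rho> * real n \<le> real t"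
    and \<rho>: "0 < \<rho>" and \<alpha>: "0 < \<alpha>" "\<alpha> < 1" and D: "0 < D1" "0 < D2"
    and ind: "indep_vars (\<lambda>_. borel) X (vertex_pairs n)"
    and X01: "\<And>e \<omega>. e \<in> vertex_pairs n \<Longrightarrow> \<omega> \<in> space M \<Longrightarrow> X e \<omega> \<in> {0..1}"
    and cdf_lower: "\<And>e x. e \<in> vertex_pairs n \<Longrightarrow> 0 \<le> x \<Longrightarrow> x \<le> 1 \<Longrightarrow>
      D1 * x powr (1 / \<alpha>) \<le> prob {\<omega> \<in> space M. X e \<omega> \<le> x}"
    and cdf_upper: "\<And>e x. e \<in> vertex_pairs n \<Longrightarrow> 0 \<le> x \<Longrightarrow> x \<le> 1 \<Longrightarrow>
      prob {\<omega> \<in> space M. X e \<omega> \<le> x} \<le> D2 * x powr (1 / \<alpha>)"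
    and c: "0 < c" "c \<le> 1" "D2 * c powr (1 / \<alpha>) \<le> exp (- 6 / \<rho>)" "D2 * c powr (1 / \<alpha>) \<le> \<rho> / 2"
    and B: "B = 1 / ((1 - exp (- D1)) * (1 - \<alpha>))"
  defines "W \<equiv> \<lambda>\<omega>. min_tree_weight n t (\<lambda>i j. X (i, j) \<omega>)"
  shows "1 - exp (- (real n powr (1 - \<alpha>)))
      \<le> prob {\<omega> \<in> space M. c * \<rho> / 2 * real n powr (1 - \<alpha>) \<le> W \<omega> \<and> W \<omega> \<le> (2 * B + 2) * real n powr (1 - \<alpha>)}"
    and "c * \<rho> / 2 * real n powr (1 - \<alpha>) \<le> expectation W"
    and "expectation W \<le> (2 * B + 2) * real n powr (1 - \<alpha>)"
proof -
  define m where "m = real n powr (1 - \<alpha>)"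
  \<comment> \<open>The bound \<open>c \<le> 1\<close> puts \<open>x\<close> into the unit interval,
    where the distribution functions are controlled; at \<open>x\<close> the upper bound equals
    \<open>\<delta> / n\<close>.\<close>
  define x where "x = c * real n powr (- \<alpha>)"
  define \<delta> where "\<delta> = D2 * c powr (1 / \<alpha>)"
  define L where "L \<omega> = real (card {(i, j) \<in> vertex_pairs n. X (i, j) \<omega> \<le> x})" for \<omega>
  define Z where "Z i \<omega> = (MIN j\<in>{1..<i}. X (j, i) \<omega>)" for i \<omega>
  have n1: "1 \<le> n" using n by simp
  \<comment> \<open>The upper bound weakens a decay in \<open>n\<close> to one in \<open>m\<close>;
    the lower bound later absorbs the factor 2 of the union bound.\<close>
  have m: "1 \<le> m" "m \<le> real n"
    using powr_mono[of "1 - \<alpha>" 1 "real n"] ge_one_powr_ge_zero[of "real n" "1 - \<alpha>"] n \<alpha>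
    by (auto simp: m_def)
  have xn: "x * real n = c * m"
    using n by (simp add: x_def m_def powr_diff powr_minus field_simps)
  have "real n powr (- \<alpha>) \<le> 1"
    using n \<alpha> by (simp add: powr_minus ge_one_powr_ge_zero inverse_le_1_iff)
  then have x: "0 \<le> x" "x \<le> 1"
    using c mult_mono[of c 1 "real n powr (- \<alpha>)" 1] by (auto simp: x_def)
  have "x powr (1 / \<alpha>) = c powr (1 / \<alpha>) * (real n powr (- \<alpha>)) powr (1 / \<alpha>)"
    unfolding x_def by (rule powr_mult)
  also have "(real n powr (- \<alpha>)) powr (1 / \<alpha>) = real n powr (- 1)"
    unfolding powr_powr using \<alpha> by simp
  finally have "D2 * x powr (1 / \<alpha>) = \<delta> / real n"
    using n by (simp add: \<delta>_def powr_minus divide_inverse)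
  then have light: "prob {\<omega> \<in> space M. X e \<omega> \<le> x} \<le> \<delta> / real n" if "e \<in> vertex_pairs n" for e
    using cdf_upper[OF that x] by simp
  have \<delta>: "0 \<le> \<delta>" using D by (simp add: \<delta>_def)
  have X_meas: "X e \<in> borel_measurable M" if "e \<in> vertex_pairs n" for e
    using ind that by (auto simp: indep_vars_def)
  have W_meas[measurable]: "W \<in> borel_measurable M"
    unfolding W_def using X_meas by (intro measurable_min_tree_weight[OF n1 n(2)])
  have W_int: "integrable M W"
    using min_tree_weight_bounds[OF n1 n(2)] X01
    by (intro integrable_bounded(1)[OF W_meas, where B = "real n"]) (simp add: W_def)
  have L_meas[measurable]: "L \<in> borel_measurable M"
    unfolding L_def by (rule light_edges_measurable[OF ind n1 \<delta> light])
  have "card {(i, j) \<in> vertex_pairs n. X (i, j) \<omega> \<le> x} \<le> card (vertex_pairs n)" for \<omega>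
    using finite_vertex_pairs by (intro card_mono) auto
  then have L_int: "integrable M L"
    by (intro integrable_bounded(1)[OF L_meas, where B = "real (card (vertex_pairs n))"]) (simp add: L_def)
  have Z_ind: "indep_vars (\<lambda>_. borel) Z {2..n}"
    unfolding Z_def by (rule indep_vars_best_edge[OF ind])
  then have Z_meas: "Z i \<in> borel_measurable M" if "i \<in> {2..n}" for i
    using that by (auto simp: indep_vars_def)
  have Z01: "Z i \<omega> \<in> {0..1}" if "i \<in> {2..n}" "\<omega> \<in> space M" for i \<omega>
  proof -
    have "Z i \<omega> \<in> (\<lambda>j. X (j, i) \<omega>) ` {1..<i}"
      unfolding Z_def using that by (intro Min_in) auto
    then obtain j where "Z i \<omega> = X (j, i) \<omega>" "j \<in> {1..<i}" by blast
    then show ?thesis using X01[OF _ that(2), of "(j, i)"] that by (simp add: vertex_pairs_def)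
  qed
  have Z_int: "integrable M (Z i)" if "i \<in> {2..n}" for i
    using Z01[OF that] by (intro integrable_bounded(1)[OF Z_meas[OF that], where B = 1]) auto
  have S_meas[measurable]: "(\<lambda>\<omega>. \<Sum>i=2..n. Z i \<omega>) \<in> borel_measurable M"
    by (intro borel_measurable_sum Z_meas)
  have EZ: "(\<Sum>i=2..n. expectation (Z i)) \<le> B * m"
    unfolding Z_def B m_def
    by (rule recursive_tree_weight_expectation[OF ind X01 \<alpha> D(1) cdf_lower])
  have lower: "x * (\<rho> * real n - L \<omega>) \<le> W \<omega>" if "\<omega> \<in> space M" for \<omega>
  proof -
    have "x * (\<rho> * real n - L \<omega>) \<le> x * (real t - L \<omega>)"
      using n x by (intro mult_left_mono) auto
    also have "\<dots> \<le> W \<omega>"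
      unfolding W_def L_def using X01[OF _ that] x by (intro min_tree_weight_ge_light[OF n1 n(2)]) auto
    finally show ?thesis .
  qed
  have upper: "W \<omega> \<le> (\<Sum>i=2..n. Z i \<omega>)" for \<omega>
    unfolding W_def Z_def by (rule min_tree_weight_le_recursive[OF n1 n(2)])
  have B0: "0 \<le> B" using B \<alpha> D by simp

  show "c * \<rho> / 2 * real n powr (1 - \<alpha>) \<le> expectation W"
  proof -
    have "c * \<rho> / 2 * m = x * (\<rho> * real n - \<rho> / 2 * real n)"
      using xn by (simp add: algebra_simps)
    also have "\<dots> \<le> x * (\<rho> * real n - \<delta> * real n)"
      using c(4) x unfolding \<delta>_def by (intro mult_left_mono diff_left_mono mult_right_mono) auto
    also have "\<dots> \<le> x * (\<rho> * real n - expectation L)"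
      using light_edges_expectation[OF ind n1 \<delta> light] x
      unfolding L_def by (intro mult_left_mono diff_left_mono) auto
    also have "\<dots> = expectation (\<lambda>\<omega>. x * (\<rho> * real n - L \<omega>))"
      using L_int by (simp add: prob_space)
    also have "\<dots> \<le> expectation W"
      using lower L_int W_int by (intro integral_mono) auto
    finally show ?thesis by (simp add: m_def)
  qed
  show "expectation W \<le> (2 * B + 2) * real n powr (1 - \<alpha>)"
  proof -
    have "expectation W \<le> expectation (\<lambda>\<omega>. \<Sum>i=2..n. Z i \<omega>)"
      using upper W_int Z_int by (intro integral_mono) auto
    also have "\<dots> = (\<Sum>i=2..n. expectation (Z i))"
      using Z_int by (intro Bochner_Integration.integral_sum) auto
    also have "\<dots> \<le> (2 * B + 2) * m"
      using EZ m B0 by (elim order_trans) (intro mult_right_mono, auto)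
    finally show ?thesis by (simp add: m_def)
  qed

  let ?bad1 = "{\<omega> \<in> space M. \<rho> / 2 * real n \<le> L \<omega>}"
  let ?bad2 = "{\<omega> \<in> space M. (2 * B + 2) * m \<le> (\<Sum>i=2..n. Z i \<omega>)}"
  let ?good = "{\<omega> \<in> space M. c * \<rho> / 2 * m \<le> W \<omega> \<and> W \<omega> \<le> (2 * B + 2) * m}"
  \<comment> \<open>With parameter \<open>6 / \<rho>\<close> the threshold
    \<open>\<rho> / 2 * n\<close> contributes \<open>-3 * n\<close> to the exponent, and the mean
    gives back at most \<open>n\<close>.\<close>
  have "prob ?bad1 \<le> exp (exp (6 / \<rho>) * \<delta> * real n - 6 / \<rho> * (\<rho> / 2 * real n))"
    unfolding L_def using \<rho> by (intro light_edges_tail[OF ind n1 \<delta> light]) auto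
  also have "\<dots> \<le> exp (- 2 * m)"
  proof -
    have "exp (6 / \<rho>) * \<delta> \<le> exp (6 / \<rho>) * exp (- 6 / \<rho>)"
      using c(3) unfolding \<delta>_def by (intro mult_left_mono) auto
    also have "\<dots> = 1" by (simp flip: exp_add)
    finally have "exp (6 / \<rho>) * \<delta> * real n \<le> 1 * real n" by (intro mult_right_mono) auto
    moreover have "6 / \<rho> * (\<rho> / 2 * real n) = 3 * real n" using \<rho> by simp
    ultimately have "exp (6 / \<rho>) * \<delta> * real n - 6 / \<rho> * (\<rho> / 2 * real n) \<le> real n - 3 * real n"
      by (simp only: mult_1 diff_right_mono)
    also have "\<dots> \<le> - 2 * m" using m by simp
    finally show ?thesis by (simp only: exp_le_cancel_iff)
  qed
  finally have bad1: "prob ?bad1 \<le> exp (- 2 * m)" .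
  \<comment> \<open>Parameter 1 suffices: \<open>exp 1 - 1\<close> is at most 2, so the mean
    contributes at most \<open>2 * B * m\<close>. The extra 2 in \<open>2 * B + 2\<close> leaves
    \<open>-2 * m\<close>.\<close>
  have "prob ?bad2 \<le> exp ((exp 1 - 1) * (\<Sum>i=2..n. expectation (Z i)) - 1 * ((2 * B + 2) * m))"
    using Z_ind Z01 by (intro chernoff_unit_interval) auto
  also have "\<dots> \<le> exp (- 2 * m)"
  proof -
    have "0 \<le> (\<Sum>i=2..n. expectation (Z i))"
      using Z01 by (intro sum_nonneg integral_nonneg_AE AE_I2) auto
    then have "(exp 1 - 1) * (\<Sum>i=2..n. expectation (Z i)) \<le> 2 * (B * m)"
      using EZ exp_le by (intro mult_mono) auto
    then show ?thesis by (simp add: algebra_simps)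
  qed
  finally have bad2: "prob ?bad2 \<le> exp (- 2 * m)" .
  have sub: "space M - ?good \<subseteq> ?bad1 \<union> ?bad2"
  proof
    fix \<omega> assume "\<omega> \<in> space M - ?good"
    then have \<omega>: "\<omega> \<in> space M" "W \<omega> < c * \<rho> / 2 * m \<or> (2 * B + 2) * m < W \<omega>" by auto
    have "\<rho> / 2 * real n \<le> L \<omega>" if "W \<omega> < c * \<rho> / 2 * m"
    proof (rule ccontr)
      assume "\<not> ?thesis"
      then have "x * (\<rho> * real n - \<rho> / 2 * real n) \<le> x * (\<rho> * real n - L \<omega>)"
        using x by (intro mult_left_mono diff_left_mono) auto
      moreover have "x * (\<rho> * real n - \<rho> / 2 * real n) = c * \<rho> / 2 * m"
        using xn by (simp add: algebra_simps)
      ultimately show False using lower[OF \<omega>(1)] that by linarith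
    qed
    moreover have "(2 * B + 2) * m \<le> (\<Sum>i=2..n. Z i \<omega>)" if "(2 * B + 2) * m < W \<omega>"
      using upper[of \<omega>] that by linarith
    ultimately show "\<omega> \<in> ?bad1 \<union> ?bad2" using \<omega> by blast
  qed
  have "1 - prob ?good = prob (space M - ?good)"
    by (subst prob_compl) auto
  also have "\<dots> \<le> prob (?bad1 \<union> ?bad2)"
    using sub by (intro finite_measure_mono) auto
  also have "\<dots> \<le> prob ?bad1 + prob ?bad2"
    by (intro measure_Un_le) auto
  also have "\<dots> \<le> 2 * exp (- 2 * m)" using bad1 bad2 by simp
  \<comment> \<open>Half of the exponent pays for the factor 2, so that the constant in the final
    exponent is 1.\<close>
  also have "\<dots> \<le> exp m * exp (- 2 * m)"
  proof (rule mult_right_mono)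
    show "2 \<le> exp m" using exp_ge_add_one_self[of m] m(1) by linarith
  qed simp
  also have "\<dots> = exp (- m)" by (simp flip: exp_add)
  finally show "1 - exp (- (real n powr (1 - \<alpha>)))
      \<le> prob {\<omega> \<in> space M. c * \<rho> / 2 * real n powr (1 - \<alpha>) \<le> W \<omega> \<and> W \<omega> \<le> (2 * B + 2) * real n powr (1 - \<alpha>)}"
    by (simp add: m_def)
qed

section \<open>Choice of constants and passage to clamped weights\<close>

theorem theorem2p1:
  fixes \<rho> \<alpha> D1 D2 :: real
    and N :: "nat set"
    and \<tau> :: "nat \<Rightarrow> nat"
    and P :: "nat \<Rightarrow> 'a measure"
    and w :: "nat \<Rightarrow> nat \<Rightarrow> nat \<Rightarrow> 'a \<Rightarrow> real"
  assumes rho: "0 < \<rho>" "\<rho> \<le> 1"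
    and alpha: "0 < \<alpha>" "\<alpha> < 1"
    and D: "0 < D1" "D1 \<le> D2"
    and tau: "\<And>n. n \<in> N \<Longrightarrow> 1 \<le> \<tau> n \<and> \<tau> n \<le> n - 1 \<and> \<rho> * real n \<le> real (\<tau> n)"
    and prob: "\<And>n. n \<in> N \<Longrightarrow> prob_space (P n)"
    and indep: "\<And>n. n \<in> N \<Longrightarrow>
      prob_space.indep_vars (P n) (\<lambda>_. borel) (\<lambda>(i, j). w n i j) {(i, j). 1 \<le> i \<and> i < j \<and> j \<le> n}"
    and le_1: "\<And>n i j. \<lbrakk>n \<in> N; 1 \<le> i; i < j; j \<le> n\<rbrakk> \<Longrightarrow> AE \<omega> in P n. w n i j \<omega> \<le> 1"
    and cdf_bounds: "\<And>n i j x. \<lbrakk>n \<in> N; 1 \<le> i; i < j; j \<le> n; 0 \<le> x; x \<le> 1\<rbrakk> \<Longrightarrow>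
      D1 * x powr (1 / \<alpha>) \<le> cdf (distr (P n) borel (w n i j)) x \<and>
      cdf (distr (P n) borel (w n i j)) x \<le> D2 * x powr (1 / \<alpha>)"
  shows "let M = (\<lambda>n \<omega>. min_tree_weight n (\<tau> n) (\<lambda>i j. w n i j \<omega>)) in
    (\<exists>C1 > 0. \<exists>C2 > 0. \<exists>C3 > 0. \<forall>n \<in> N.
      measure (P n) {\<omega> \<in> space (P n).
          C1 * real n powr (1 - \<alpha>) \<le> M n \<omega> \<and> M n \<omega> \<le> C2 * real n powr (1 - \<alpha>)}
        \<ge> 1 - exp (- C3 * real n powr (1 - \<alpha>)) \<and>
      C1 * real n powr (1 - \<alpha>) \<le> prob_space.expectation (P n) (M n) \<and>
      prob_space.expectation (P n) (M n) \<le> C2 * real n powr (1 - \<alpha>)) \<and>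
    (\<forall>n \<in> N. prob_space.variance (P n) (M n) \<le> 2 * real n)"
proof -
  text \<open>
    An edge is lighter than $c\, n^{-\alpha}$ with probability at most \<open>\<delta> / n\<close>: the bound
    \<open>\<rho> / 2\<close> keeps the mean number of such edges small, and \<open>exp (- 6 / \<rho>)\<close> absorbs the factor from
    the Chernoff bound with parameter \<open>6 / \<rho>\<close>.
  \<close>
  define \<delta> where "\<delta> = min (exp (- 6 / \<rho>)) (\<rho> / 2)"
  \<comment> \<open>The second argument solves \<open>D2 * c powr (1 / \<alpha>) = \<delta>\<close>;
    the cap at 1 keeps the light threshold in the unit interval.\<close>
  define c where "c = min 1 ((\<delta> / D2) powr \<alpha>)"
  define B where "B = 1 / ((1 - exp (- D1)) * (1 - \<alpha>))"
  have D2: "0 < D2" using D by simp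
  have \<delta>: "0 < \<delta>" using rho by (simp add: \<delta>_def)
  have c: "0 < c" "c \<le> 1" using \<delta> D2 by (auto simp: c_def)
  have "c powr (1 / \<alpha>) \<le> ((\<delta> / D2) powr \<alpha>) powr (1 / \<alpha>)"
    using c alpha by (intro powr_mono2) (auto simp: c_def)
  also have "\<dots> = \<delta> / D2"
    unfolding powr_powr using alpha \<delta> D2 by simp
  finally have "D2 * c powr (1 / \<alpha>) \<le> \<delta>"
    using D2 by (simp add: field_simps)
  then have c': "D2 * c powr (1 / \<alpha>) \<le> exp (- 6 / \<rho>)" "D2 * c powr (1 / \<alpha>) \<le> \<rho> / 2"
    by (auto simp: \<delta>_def)
  have B: "0 \<le> B" using D alpha by (simp add: B_def)
  define M where "M n \<omega> = min_tree_weight n (\<tau> n) (\<lambda>i j. w n i j \<omega>)" for n \<omega>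
  have main: "1 - exp (- (real n powr (1 - \<alpha>))) \<le> measure (P n) {\<omega> \<in> space (P n).
        c * \<rho> / 2 * real n powr (1 - \<alpha>) \<le> M n \<omega> \<and> M n \<omega> \<le> (2 * B + 2) * real n powr (1 - \<alpha>)}"
    "c * \<rho> / 2 * real n powr (1 - \<alpha>) \<le> prob_space.expectation (P n) (M n)"
    "prob_space.expectation (P n) (M n) \<le> (2 * B + 2) * real n powr (1 - \<alpha>)"
    "prob_space.variance (P n) (M n) \<le> real n"
    if nN: "n \<in> N" for n
  proof -
    interpret prob_space "P n" by (rule prob[OF nN])
    have n: "2 \<le> n" "\<tau> n \<le> n - 1" "\<rho> * real n \<le> real (\<tau> n)"
      using tau[OF nN] by auto
    then have n1: "1 \<le> n" by simp
    have ind_w: "indep_vars (\<lambda>_. borel) (\<lambda>(i, j). w n i j) (vertex_pairs n)"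
      using indep[OF nN] by (simp add: vertex_pairs_def)
    define X where "X e \<omega> = max 0 (min 1 (w n (fst e) (snd e) \<omega>))" for e \<omega>
    have w_meas: "w n i j \<in> borel_measurable (P n)" if "(i, j) \<in> vertex_pairs n" for i j
      using ind_w that by (auto simp: indep_vars_def)
    have X_meas: "X e \<in> borel_measurable (P n)" if "e \<in> vertex_pairs n" for e
      unfolding X_def[abs_def] using w_meas[of "fst e" "snd e"] that by simp
    have ind: "indep_vars (\<lambda>_. borel) X (vertex_pairs n)"
    proof -
      have "indep_vars (\<lambda>_. borel) (\<lambda>e \<omega>. (\<lambda>x. max 0 (min 1 x)) ((\<lambda>(i, j). w n i j) e \<omega>)) (vertex_pairs n)"
        by (rule indep_vars_compose2[OF ind_w]) simp
      then show ?thesis by (simp add: X_def[abs_def] case_prod_beta')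
    qed
    have X01: "X e \<omega> \<in> {0..1}" for e \<omega> by (simp add: X_def)
    have cdf_eq: "cdf (distr (P n) borel (w n i j)) x = prob {\<omega> \<in> space (P n). w n i j \<omega> \<le> x}"
      if "(i, j) \<in> vertex_pairs n" for i j x
      using w_meas[OF that] by (simp add: cdf_def measure_distr vimage_def Int_def conj_commute)
    have X_ae: "AE \<omega> in P n. X (i, j) \<omega> = w n i j \<omega>" if ij: "(i, j) \<in> vertex_pairs n" for i j
    proof -
      \<comment> \<open>Positivity of the weights is hidden in the upper bound on the distribution
        function at \<open>x = 0\<close>.\<close>
      have "prob {\<omega> \<in> space (P n). w n i j \<omega> \<le> 0} \<le> 0"
        using cdf_bounds[OF nN, of i j 0] ij cdf_eq[OF ij, of 0] by (simp add: vertex_pairs_def)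
      then have "prob {\<omega> \<in> space (P n). w n i j \<omega> \<le> 0} = 0"
        using measure_nonneg by (rule antisym)
      then have "AE \<omega> in P n. \<not> w n i j \<omega> \<le> 0"
        using w_meas[OF ij] by (subst (asm) prob_eq_0) auto
      moreover have "AE \<omega> in P n. w n i j \<omega> \<le> 1"
        using le_1[OF nN] ij by (simp add: vertex_pairs_def)
      ultimately show ?thesis by eventually_elim (auto simp: X_def)
    qed
    have cdf_X: "prob {\<omega> \<in> space (P n). X e \<omega> \<le> x} = cdf (distr (P n) borel (w n (fst e) (snd e))) x"
      if e: "e \<in> vertex_pairs n" for e x
    proof -
      have e': "(fst e, snd e) \<in> vertex_pairs n" using e by simp
      show ?thesis
        unfolding cdf_eq[OF e'] using X_ae[OF e'] X_meas[OF e] w_meas[OF e']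
        by (intro measure_eq_AE) auto
    qed
    have lower: "D1 * x powr (1 / \<alpha>) \<le> prob {\<omega> \<in> space (P n). X e \<omega> \<le> x}"
      and upper: "prob {\<omega> \<in> space (P n). X e \<omega> \<le> x} \<le> D2 * x powr (1 / \<alpha>)"
      if "e \<in> vertex_pairs n" "0 \<le> x" "x \<le> 1" for e x
      using cdf_bounds[OF nN _ _ _ that(2,3), of "fst e" "snd e"] that(1)
      unfolding cdf_X[OF that(1)] by (auto simp: vertex_pairs_def)
    define W where "W \<omega> = min_tree_weight n (\<tau> n) (\<lambda>i j. X (i, j) \<omega>)" for \<omega>
    have W_meas: "W \<in> borel_measurable (P n)"
      unfolding W_def using X_meas by (intro measurable_min_tree_weight[OF n1 n(2)])
    have M_meas: "M n \<in> borel_measurable (P n)"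
      unfolding M_def using measurable_min_tree_weight[OF n1 n(2), of "\<lambda>(i, j). w n i j" "P n"] w_meas by simp
    have "AE \<omega> in P n. \<forall>e\<in>vertex_pairs n. X e \<omega> = w n (fst e) (snd e) \<omega>"
      using X_ae by (intro AE_finite_allI finite_vertex_pairs) auto
    then have W_ae: "AE \<omega> in P n. M n \<omega> = W \<omega>"
    proof eventually_elim
      case (elim \<omega>)
      then show ?case unfolding M_def W_def by (intro min_tree_weight_cong) fastforce
    qed
    have exp_eq: "expectation (M n) = expectation W"
      using W_ae M_meas W_meas by (intro integral_cong_AE) auto
    note order = min_tree_weight_order[OF n rho(1) alpha D(1) D2 ind X01 lower upper c c' B_def, folded W_def]
    have "measure (P n) {\<omega> \<in> space (P n).
          c * \<rho> / 2 * real n powr (1 - \<alpha>) \<le> M n \<omega> \<and> M n \<omega> \<le> (2 * B + 2) * real n powr (1 - \<alpha>)}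
      = prob {\<omega> \<in> space (P n).
          c * \<rho> / 2 * real n powr (1 - \<alpha>) \<le> W \<omega> \<and> W \<omega> \<le> (2 * B + 2) * real n powr (1 - \<alpha>)}"
      using W_ae M_meas W_meas by (intro measure_eq_AE) auto
    with order(1) show "1 - exp (- (real n powr (1 - \<alpha>))) \<le> measure (P n) {\<omega> \<in> space (P n).
        c * \<rho> / 2 * real n powr (1 - \<alpha>) \<le> M n \<omega> \<and> M n \<omega> \<le> (2 * B + 2) * real n powr (1 - \<alpha>)}"
      by simp
    show "c * \<rho> / 2 * real n powr (1 - \<alpha>) \<le> expectation (M n)"
      "expectation (M n) \<le> (2 * B + 2) * real n powr (1 - \<alpha>)"
      by (simp_all only: exp_eq order(2,3))
    have "variance (M n) = variance W"
      unfolding exp_eq using W_ae M_meas W_meas by (intro integral_cong_AE) auto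
    then show "variance (M n) \<le> real n"
      using variance_min_tree_weight_le[OF n(1,2) ind X01, folded W_def] by simp
  qed
  have "0 < c * \<rho> / 2" "0 < 2 * B + 2" using c rho B by auto
  moreover have "prob_space.variance (P n) (M n) \<le> 2 * real n" if "n \<in> N" for n
    using main(4)[OF that] by simp
  ultimately show ?thesis
    unfolding Let_def M_def[symmetric]
    using main(1-3) by (intro conjI exI[of _ "c * \<rho> / 2"] exI[of _ "2 * B + 2"] exI[of _ "1::real"] ballI) auto
qed

end
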